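(* Let $p,q$ be coprime positive integers with $p<q$ (so $p/q<1$ is a positive rational number in reduced form). Then: \begin{enumerate} \item If $q<2p$, then there exists a mass $\mu$ on $\mathbb{R}^2$ that admits no convex $(q,p)$-spiral equicovering. \item If $q<3p-3$, then there exists a mass $\mu$ on $\mathbb{R}^2$ that admits no convex $(q,p)$-spiral equicovering. \item If $q=3p-3$ and $p$ is odd, then every mass $\mu$ on $\mathbb{R}^2$ admits a convex $(q,p)$-spiral equicovering. \item If $3p-3<q<3p$ and $p\geq 2$, then every mass $\mu$ on $\mathbb{R}^2$ admits a convex $(q,p)$-spiral equicovering. \item If $q\geq 3p$, then every mass $\mu$ on $\mathbb{R}^2$ admits a convex $(q,p)$-spiral equicovering. \end{enumerate}
   Context: A mass is a Borel probability measure $\mu$ on $\mathbb{R}^2$ such that $\mu(L)=0$ for every line $L\subset\mathbb{R}^2$. A $k$-fan consists of $k$ rays $\ell_1,\dots,\ell_k$ emanating from a common point $O\in\mathbb{R}^2$, ordered counter-clockwise around $O$. Indices are taken modulo $k$. For $i=1,\dots,k$, the wedge $V_i$ is the closed region obtained by sweeping the ray $\ell_i$ counter-clockwise around $O$ until it reaches $\ell_{i+1}$. For a positive integer $r<k$, the $r$-wedge $W_i$ is the closed region obtained by sweeping $\ell_i$ counter-clockwise around $O$ until it reaches $\ell_{i+r}$; equivalently $W_i=\bigcup_{j=i}^{i+r-1}V_j$. The collection $\{W_1,\dots,W_k\}$ is called a $(k,r)$-spiral; it is called a convex $(k,r)$-spiral if every $W_i$ is convex. (Every point of the plane not on one of the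 rays $\ell_i$ is covered exactly $r$ times by a $(k,r)$-spiral.) For coprime positive integers $p<q$ and a mass $\mu$, a convex $(q,p)$-spiral equicovering of $\mu$ is a convex $(q,p)$-spiral $\{W_1,\dots,W_q\}$ such that $\mu(W_i)=p/q$ for every $i=1,\dots,q$. The mass $\mu$ admits a convex $(q,p)$-spiral equicovering if one exists for some choice of $O$ and rays $\ell_1,\dots,\ell_q$. *)

theory Defs
  imports "HOL-Probability.Probability"
begin

definition mass :: "(real^2) measure \<Rightarrow> bool" where
  "mass \<mu> \<longleftrightarrow> prob_space \<mu> \<and> sets \<mu> = sets borel \<and>
     (\<forall>L. affine L \<and> aff_dim L = 1 \<longrightarrow> measure \<mu> L = 0)"

definition ray :: "real^2 \<Rightarrow> real \<Rightarrow> (real^2) set" where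
  "ray c t = {c + s *\<^sub>R vector [cos t, sin t] | s. 0 \<le> s}"

text \<open>A \<open>k\<close>-fan with apex \<open>c\<close> is encoded by an angle sequence \<open>\<theta>\<close>: its \<open>i\<close>-th ray is
  \<open>ray c (\<theta> i)\<close>. The angles are lifted along the counter-clockwise order, so that going around
  once adds \<open>2 * pi\<close>; since \<open>ray c\<close> is \<open>2 * pi\<close>-periodic, the rays (and the wedges below) depend
  on the index only modulo \<open>k\<close>. The rays of a fan are pairwise distinct.\<close>

definition fan_angles :: "nat \<Rightarrow> (nat \<Rightarrow> real) \<Rightarrow> bool" where
  "fan_angles k \<theta> \<longleftrightarrow> (\<forall>i. \<theta> i < \<theta> (Suc i)) \<and> (\<forall>i. \<theta> (i + k) = \<theta> i + 2 * pi)"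

text \<open>The region swept by a ray turning counter-clockwise from angle \<open>a\<close> to angle \<open>b \<ge> a\<close>.\<close>

definition sweep :: "real^2 \<Rightarrow> real \<Rightarrow> real \<Rightarrow> (real^2) set" where
  "sweep c a b = (\<Union>t\<in>{a..b}. ray c t)"

definition r_wedge :: "nat \<Rightarrow> real^2 \<Rightarrow> (nat \<Rightarrow> real) \<Rightarrow> nat \<Rightarrow> (real^2) set" where
  "r_wedge r c \<theta> i = sweep c (\<theta> i) (\<theta> (i + r))"

text \<open>Spirals are indexed families \<open>W 1, \<dots>, W k\<close>; values of \<open>W\<close> at other indices are irrelevant.\<close>

definition spiral :: "nat \<Rightarrow> nat \<Rightarrow> (nat \<Rightarrow> (real^2) set) \<Rightarrow> bool" where
  "spiral k r W \<longleftrightarrow> 0 < r \<and> r < k \<and>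
     (\<exists>c \<theta>. fan_angles k \<theta> \<and> (\<forall>i\<in>{1..k}. W i = r_wedge r c \<theta> i))"

definition convex_spiral :: "nat \<Rightarrow> nat \<Rightarrow> (nat \<Rightarrow> (real^2) set) \<Rightarrow> bool" where
  "convex_spiral k r W \<longleftrightarrow> spiral k r W \<and> (\<forall>i\<in>{1..k}. convex (W i))"

definition convex_spiral_equicovering ::
    "nat \<Rightarrow> nat \<Rightarrow> (real^2) measure \<Rightarrow> (nat \<Rightarrow> (real^2) set) \<Rightarrow> bool" where
  "convex_spiral_equicovering q p \<mu> W \<longleftrightarrow> convex_spiral q p W \<and>
     (\<forall>i\<in>{1..q}. measure \<mu> (W i) = real p / real q)"

definition admits_convex_spiral_equicovering :: "nat \<Rightarrow> nat \<Rightarrow> (real^2) measure \<Rightarrow> bool" where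
  "admits_convex_spiral_equicovering q p \<mu> \<longleftrightarrow> (\<exists>W. convex_spiral_equicovering q p \<mu> W)"

end

theory Submission imports Defs begin

text \<open>Call a fan \<^emph>\<open>narrow\<close> if every \<open>p\<close> consecutive wedges together have angle at most \<open>\<pi>\<close>; this is convexity
  of the \<open>p\<close>-wedges. Since \<open>p\<close> and \<open>q\<close> are coprime, all \<open>p\<close>-wedges have measure \<open>p / q\<close> exactly when all
  wedges between neighbouring rays have measure \<open>1 / q\<close> (lemma \<open>admits_equi_fan\<close>). So the question is for which
  \<open>p\<close> and \<open>q\<close> every mass has a narrow fan that cuts it into \<open>q\<close> equal parts.

  Obstruction. Two consecutive narrow steps turn by at most \<open>2\<pi>\<close>, hence \<open>2p \<le> q\<close>. Moreover a half plane bounded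
  by a line through the apex contains \<open>p - 1\<close> consecutive wedges, so it has measure at least \<open>(p - 1) / q\<close>
  (\<open>equi_fan_depth\<close>). A mass spread over three small discs at the corners of a triangle has,
  through every point, a half plane of measure at most \<open>1/3\<close>, which excludes \<open>q < 3p - 3\<close>.

  Existence for \<open>q > 3p - 3\<close>. First let the mass charge every nonempty open set. Then for every apex there is exactly
  one equipartitioning fan whose first ray points in a fixed direction, and it depends continuously on the apex.
  Call a \<open>p\<close>-wedge bad if its angle exceeds \<open>\<pi>\<close>; it is too light for its size, and the apex is pulled away from it,
  along its bisector, with a force that vanishes at angle \<open>\<pi>\<close>. If there were always a bad wedge, Brouwer's fixed
  point theorem would give an apex where the pulls cancel, or where on a large circle they add up to an outward force.
  In both cases there are three \<open>p\<close>-wedges that overlap cyclically (one of them may come from the outer half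
  plane, which is almost empty), so that \<open>q \<le> 3p - 3\<close>, a contradiction: this is \<open>pull_ne_outward\<close>.
  For \<open>p = 1\<close> every second ray of a fan for \<open>2\<close> and \<open>2q\<close> is taken.

  Existence for \<open>q = 3p - 3\<close> and odd \<open>p = 2m + 1\<close>. Now \<open>q = 6m\<close>. Three concurrent lines that cut the mass
  into six equal parts exist (\<open>six_partition\<close>), by an intermediate value argument in the direction of the first
  line. Cutting each of the six sectors into \<open>m\<close> equal parts gives a narrow fan: \<open>2m + 1\<close> consecutive wedges that
  start at a ray inside some sector end no later than the second sector after it, hence no later than the ray
  opposite to the first ray of the starting sector.

  A general mass is a limit of masses of full support. Apexes of narrow fans stay bounded, again by
  \<open>equi_fan_depth\<close>, so the fans converge along a subsequence; since lines are null, the limit still cuts the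
  mass into equal parts, and narrowness is a closed condition (\<open>equi_fan_narrow_limit\<close>).\<close>

section \<open>Polar coordinates and wedges in the plane\<close>

definition dir :: "real \<Rightarrow> real^2" where "dir t = vector [cos t, sin t]"

lemma dir_nth [simp]: "dir t $ 1 = cos t" "dir t $ 2 = sin t"
  by (simp_all add: dir_def)

lemma inner_dir: "dir a \<bullet> dir b = cos (a - b)"
  by (simp add: inner_vec_def sum_2 cos_diff)

lemma norm_dir [simp]: "norm (dir t) = 1"
  by (simp add: norm_eq_sqrt_inner inner_dir)

lemma dir_nonzero [simp]: "dir t \<noteq> 0"
  by (metis norm_dir norm_zero zero_neq_one)

lemma dir_periodic [simp]: "dir (t + 2 * pi) = dir t"
  by (simp add: vec_eq_iff forall_2)

lemma dir_shift_nat [simp]: "dir (t + 2 * pi * real k) = dir t"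
proof (induction k)
  case (Suc k)
  have "dir (t + 2 * pi * real (Suc k)) = dir ((t + 2 * pi * real k) + 2 * pi)"
    by (simp add: algebra_simps)
  then show ?case using Suc by (simp only: dir_periodic)
qed simp

lemma dir_add_pi: "dir (t + pi) = - dir t"
  by (simp add: vec_eq_iff forall_2)

lemma dir_int_periodic [simp]: "dir (t + 2 * pi * of_int k) = dir t"
  using sin_cos_eq_iff[of "t + 2 * pi * of_int k" t] by (auto simp: vec_eq_iff forall_2)

lemma dir_eqD: "dir a = dir b \<Longrightarrow> \<exists>k::int. a = b + 2 * pi * of_int k"
  using sin_cos_eq_iff[of a b] by (auto simp: vec_eq_iff forall_2)

lemma tendsto_dir [tendsto_intros]:
  "(f \<longlongrightarrow> l) F \<Longrightarrow> ((\<lambda>x. dir (f x)) \<longlongrightarrow> dir l) F"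
proof (rule vec_tendstoI)
  fix i :: 2
  assume "(f \<longlongrightarrow> l) F"
  then show "((\<lambda>x. dir (f x) $ i) \<longlongrightarrow> dir l $ i) F"
    using exhaust_2[of i] by (auto intro: isCont_tendsto_compose[OF isCont_cos] isCont_tendsto_compose[OF isCont_sin])
qed

lemma continuous_on_dir [continuous_intros]:
  "continuous_on S f \<Longrightarrow> continuous_on S (\<lambda>x. dir (f x))"
  unfolding continuous_on by (auto intro: tendsto_dir)

lemma dir_decompose: "y = (y \<bullet> dir t) *\<^sub>R dir t + (y \<bullet> dir (t + pi/2)) *\<^sub>R dir (t + pi/2)"
proof -
  have *: "z * (cos t * cos t) + z * (sin t * sin t) = z" for z :: real
    using sin_cos_squared_add3[of t] by (metis add.commute mult.right_neutral distrib_left)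
  have "y$1 = (y$1 * cos t + y$2 * sin t) * cos t + (y$2 * cos t - y$1 * sin t) * (- sin t)"
       "y$2 = (y$1 * cos t + y$2 * sin t) * sin t + (y$2 * cos t - y$1 * sin t) * cos t"
    using *[of "y$1"] *[of "y$2"] by (simp_all add: algebra_simps)
  then show ?thesis
    by (simp add: vec_eq_iff forall_2 inner_vec_def sum_2 cos_add sin_add algebra_simps)
qed

lemma polar_form:
  obtains \<rho> t where "0 \<le> \<rho>" "a \<le> t" "t < a + 2 * pi" "x = \<rho> *\<^sub>R dir t"
proof (cases "x = 0")
  case True
  show ?thesis by (rule that[of 0 a]) (use True in auto)
next
  case False
  define y where "y = x /\<^sub>R norm x"
  have "norm y = 1" using False by (simp add: y_def)
  then have "(y$1)\<^sup>2 + (y$2)\<^sup>2 = 1" by (simp add: norm_vec_def L2_set_def sum_2)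
  then obtain t where t: "y$1 = cos t" "y$2 = sin t" by (metis sincos_total_2pi)
  define t' where "t' = a + 2 * pi * frac ((t - a) / (2 * pi))"
  have "t' = t + 2 * pi * of_int (- \<lfloor>(t - a) / (2 * pi)\<rfloor>)"
    by (simp add: t'_def frac_def field_simps)
  then have "dir t' = dir t" by (metis dir_int_periodic)
  moreover have "dir t = y" using t by (simp add: vec_eq_iff forall_2)
  ultimately have "x = norm x *\<^sub>R dir t'" using False by (simp add: y_def)
  moreover have "a \<le> t'" "t' < a + 2 * pi"
    by (simp_all add: t'_def frac_lt_1)
  ultimately show ?thesis by (intro that[of "norm x" t']) auto
qed

lemma ray_dir: "ray c t = {c + s *\<^sub>R dir t | s. 0 \<le> s}"
  by (simp add: ray_def dir_def)

lemma mem_sweep: "x \<in> sweep c a b \<longleftrightarrow> (\<exists>t s. a \<le> t \<and> t \<le> b \<and> 0 \<le> s \<and> x = c + s *\<^sub>R dir t)"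
  by (auto simp: sweep_def ray_dir)

text \<open>Within a window of length \<open>2\<pi>\<close> starting at the first ray, the angle of a point other than the apex is unique, so
  membership in a wedge becomes an inequality between angles.\<close>

lemma mem_sweep_polar:
  assumes "0 < s" "a \<le> t" "t < a + 2 * pi" "b \<le> a + 2 * pi"
  shows "c + s *\<^sub>R dir t \<in> sweep c a b \<longleftrightarrow> t \<le> b"
proof
  assume "c + s *\<^sub>R dir t \<in> sweep c a b"
  then obtain t' s' where *: "a \<le> t'" "t' \<le> b" "0 \<le> s'" "s *\<^sub>R dir t = s' *\<^sub>R dir t'"
    by (auto simp: mem_sweep)
  have "norm (s *\<^sub>R dir t) = norm (s' *\<^sub>R dir t')" using *(4) by (rule arg_cong)
  then have "s = s'" using *(3) assms(1) by simp
  then have "dir t = dir t'" using * assms by simp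
  then obtain k :: int where k: "t = t' + 2 * pi * of_int k" using dir_eqD by blast
  show "t \<le> b"
  proof (rule ccontr)
    assume "\<not> t \<le> b"
    then have "0 < 2 * pi * of_int k" "2 * pi * of_int k < 2 * pi" using k * assms by linarith+
    then have "0 < k" "k < 1" by (simp_all add: zero_less_mult_iff)
    then show False by simp
  qed
qed (use assms in \<open>auto simp: mem_sweep\<close>)

lemma sweep_mono: "a \<le> a' \<Longrightarrow> b' \<le> b \<Longrightarrow> sweep c a' b' \<subseteq> sweep c a b"
  unfolding sweep_def by force

lemma sweep_shift: "sweep c (a + 2 * pi * of_int k) (b + 2 * pi * of_int k) = sweep c a b"
proof -
  have 1: "sweep c a b \<subseteq> sweep c (a + 2 * pi * of_int k) (b + 2 * pi * of_int k)" for a b and k :: int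
  proof
    fix x assume "x \<in> sweep c a b"
    then obtain t s where "a \<le> t" "t \<le> b" "0 \<le> s" "x = c + s *\<^sub>R dir t" by (auto simp: mem_sweep)
    then show "x \<in> sweep c (a + 2 * pi * of_int k) (b + 2 * pi * of_int k)"
      unfolding mem_sweep by (intro exI[of _ "t + 2 * pi * of_int k"] exI[of _ s]) simp
  qed
  from 1[where a = "a + 2 * pi * of_int k" and b = "b + 2 * pi * of_int k" and k = "- k"] 1[of a b k]
  show ?thesis by auto
qed

lemma sweep_full: "sweep c a (a + 2 * pi) = UNIV"
proof -
  have "x \<in> sweep c a (a + 2 * pi)" for x
  proof -
    obtain \<rho> t where "0 \<le> \<rho>" "a \<le> t" "t < a + 2 * pi" "x - c = \<rho> *\<^sub>R dir t" by (rule polar_form)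
    then show ?thesis unfolding mem_sweep
      by (intro exI[of _ t] exI[of _ \<rho>]) (auto simp: algebra_simps)
  qed
  then show ?thesis by auto
qed

lemma sweep_Un: "a \<le> b \<Longrightarrow> b \<le> d \<Longrightarrow> sweep c a d = sweep c a b \<union> sweep c b d"
  unfolding sweep_def by (subst UN_Un [symmetric]) (simp add: ivl_disj_un_two_touch)

lemma sin_nonneg_iff_window: 
  assumes "0 \<le> t" "t < 2 * pi" shows "0 \<le> sin t \<longleftrightarrow> t \<le> pi"
  using assms sin_ge_zero sin_lt_zero by (metis linorder_not_less)

lemma sweep_eq_halfplanes:
  assumes "a < b" "b \<le> a + pi"
  shows "sweep c a b = {x. (x - c) \<bullet> dir (a + pi/2) \<ge> 0 \<and> (x - c) \<bullet> dir (b + pi/2) \<le> 0}"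
proof (intro set_eqI)
  fix x
  obtain \<rho> t where t: "0 \<le> \<rho>" "a \<le> t" "t < a + 2 * pi" "x - c = \<rho> *\<^sub>R dir t" by (rule polar_form)
  have x: "x = c + \<rho> *\<^sub>R dir t" using t by (simp add: algebra_simps)
  have in1: "(x - c) \<bullet> dir (a + pi/2) = \<rho> * sin (t - a)" "(x - c) \<bullet> dir (b + pi/2) = \<rho> * sin (t - b)"
    by (simp_all add: t inner_dir cos_diff cos_add sin_add sin_diff)
  show "x \<in> sweep c a b \<longleftrightarrow> x \<in> {x. (x - c) \<bullet> dir (a + pi/2) \<ge> 0 \<and> (x - c) \<bullet> dir (b + pi/2) \<le> 0}"
  proof (cases "\<rho> = 0")
    case True
    then have "x \<in> sweep c a b" using assms unfolding x mem_sweep by (intro exI[of _ a] exI[of _ 0]) auto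
    then show ?thesis using True by (simp add: in1)
  next
    case False
    then have "0 < \<rho>" using t by simp
    then have "x \<in> sweep c a b \<longleftrightarrow> t \<le> b" using mem_sweep_polar[of \<rho> a t b c] t assms x by simp
    moreover have "t \<le> b \<longleftrightarrow> 0 \<le> sin (t - a) \<and> sin (t - b) \<le> 0"
    proof
      assume "t \<le> b"
      then show "0 \<le> sin (t - a) \<and> sin (t - b) \<le> 0"
        using assms t sin_ge_zero[of "t - a"] sin_ge_zero[of "b - t"] sin_minus[of "b - t"] by auto
    next
      assume *: "0 \<le> sin (t - a) \<and> sin (t - b) \<le> 0"
      then have "t - a \<le> pi" using sin_nonneg_iff_window[of "t - a"] t by simp
      show "t \<le> b"
      proof (rule ccontr)
        assume "\<not> t \<le> b"
        then have "0 < sin (t - b)" using assms \<open>t - a \<le> pi\<close> by (intro sin_gt_zero) auto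
        then show False using * by simp
      qed
    qed
    ultimately show ?thesis using \<open>0 < \<rho>\<close>
      by (simp add: in1 zero_le_mult_iff mult_le_0_iff)
  qed
qed

lemma sweep_halfplane: "sweep c a (a + pi) = {x. (x - c) \<bullet> dir (a + pi/2) \<ge> 0}"
proof -
  have "dir (a + pi + pi/2) = - dir (a + pi/2)"
    using dir_add_pi[of "a + pi/2"] by (simp add: algebra_simps)
  then show ?thesis using sweep_eq_halfplanes[of a "a + pi" c] by auto
qed

lemma convex_sweep:
  assumes "a < b" "b \<le> a + pi" shows "convex (sweep c a b)"
proof -
  have "sweep c a b = {x. dir (a + pi/2) \<bullet> x \<ge> dir (a + pi/2) \<bullet> c} \<inter> {x. dir (b + pi/2) \<bullet> x \<le> dir (b + pi/2) \<bullet> c}"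
    unfolding sweep_eq_halfplanes[OF assms] by (auto simp: inner_diff_left inner_commute)
  then show ?thesis by (simp add: convex_Int convex_halfspace_ge convex_halfspace_le)
qed

lemma dir_midpoint: "dir a + dir b = (2 * cos ((b - a) / 2)) *\<^sub>R dir ((a + b) / 2)"
proof -
  have *: "a = (a + b) / 2 - (b - a) / 2" "b = (a + b) / 2 + (b - a) / 2" by (simp_all add: field_simps)
  have "dir (m - d) + dir (m + d) = (2 * cos d) *\<^sub>R dir m" for m d
    by (simp add: vec_eq_iff forall_2 cos_add cos_diff sin_add sin_diff)
  then show ?thesis using * by metis
qed

text \<open>For an angle strictly between \<open>\<pi>\<close> and \<open>2\<pi>\<close> the midpoint of unit steps along the two boundary rays lies on
  the bisector of the complementary wedge.\<close>

lemma convex_sweep_imp_le_pi: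
  assumes "convex (sweep c a b)" "a \<le> b" "b < a + 2 * pi" shows "b \<le> a + pi"
proof (rule ccontr)
  assume "\<not> b \<le> a + pi"
  define m where "m = (a + b) / 2 + pi"
  define k where "k = - cos ((b - a) / 2)"
  have "pi / 2 < (b - a) / 2" "(b - a) / 2 < pi"
    using \<open>\<not> b \<le> a + pi\<close> assms(2,3) by (simp_all add: field_simps)
  then have "cos ((b - a) / 2) < 0"
    using cos_gt_zero_pi[of "(b - a) / 2 - pi"] pi_half_gt_zero cos_minus_pi[of "(b - a) / 2"] by linarith
  then have "0 < k" by (simp add: k_def)
  have "c + 1 *\<^sub>R dir t \<in> sweep c a b" if "t = a \<or> t = b" for t
    unfolding mem_sweep using that assms(2) by (intro exI[of _ t] exI[of _ 1]) auto
  then have "(1/2) *\<^sub>R (c + 1 *\<^sub>R dir a) + (1/2) *\<^sub>R (c + 1 *\<^sub>R dir b) \<in> sweep c a b"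
    using convexD[OF assms(1)] by simp
  moreover have "(1/2) *\<^sub>R (c + 1 *\<^sub>R dir a) + (1/2) *\<^sub>R (c + 1 *\<^sub>R dir b) = c + (1/2) *\<^sub>R (dir a + dir b)"
    by (simp add: vec_eq_iff field_simps)
  moreover have "\<dots> = c + k *\<^sub>R dir m"
    unfolding dir_midpoint m_def k_def dir_add_pi by simp
  ultimately have "c + k *\<^sub>R dir m \<in> sweep c a b" by simp
  moreover have "a \<le> m" "m < a + 2 * pi" "b < m" using assms by (auto simp: m_def field_simps)
  ultimately show False using mem_sweep_polar[of k a m b c] \<open>0 < k\<close> assms by simp
qed

section \<open>Wedges and masses\<close>

text \<open>Polar angles are multivalued. Near a nonzero vector a branch is chosen with \<open>arctan\<close> in the frame turned by \<open>t\<close>,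
  so that convergence of vectors gives convergence of angles.\<close>

lemma local_polar_lift:
  assumes "y \<longlonglongrightarrow> \<rho> *\<^sub>R dir t" "0 < \<rho>"
  obtains \<tau> r where "\<tau> \<longlonglongrightarrow> t" "\<forall>\<^sub>F n in sequentially. 0 < r n \<and> y n = r n *\<^sub>R dir (\<tau> n)"
proof -
  define X where "X n = y n \<bullet> dir t" for n
  define Y where "Y n = y n \<bullet> dir (t + pi/2)" for n
  have X: "X \<longlonglongrightarrow> \<rho>"
    using tendsto_inner[OF assms(1) tendsto_const[of "dir t"]] by (simp add: X_def [abs_def] inner_dir)
  have Y: "Y \<longlonglongrightarrow> 0"
    using tendsto_inner[OF assms(1) tendsto_const[of "dir (t + pi/2)"]] by (simp add: Y_def [abs_def] inner_dir)
  define \<tau> where "\<tau> n = t + arctan (Y n / X n)" for n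
  define r where "r n = X n * sqrt (1 + (Y n / X n)\<^sup>2)" for n
  have "(\<lambda>n. t + arctan (Y n / X n)) \<longlonglongrightarrow> t + arctan (0 / \<rho>)"
    by (intro tendsto_intros X Y) (use assms in simp)
  then have "\<tau> \<longlonglongrightarrow> t" by (simp add: \<tau>_def [abs_def])
  moreover have "\<forall>\<^sub>F n in sequentially. 0 < r n \<and> y n = r n *\<^sub>R dir (\<tau> n)"
  proof -
    have "\<forall>\<^sub>F n in sequentially. 0 < X n" using order_tendstoD(1)[OF X \<open>0 < \<rho>\<close>] .
    then show ?thesis
    proof eventually_elim
      case (elim n)
      define q where "q = Y n / X n"
      have q: "0 < sqrt (1 + q\<^sup>2)" by (simp add: add_pos_nonneg)
      have "dir (\<tau> n) = cos (arctan q) *\<^sub>R dir t + sin (arctan q) *\<^sub>R dir (t + pi/2)"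
        by (simp add: \<tau>_def q_def vec_eq_iff forall_2 cos_add sin_add algebra_simps)
      then have "r n *\<^sub>R dir (\<tau> n) = (r n / sqrt (1 + q\<^sup>2)) *\<^sub>R dir t + (r n * (q / sqrt (1 + q\<^sup>2))) *\<^sub>R dir (t + pi/2)"
        by (simp add: cos_arctan sin_arctan scaleR_add_right)
      also have "r n / sqrt (1 + q\<^sup>2) = X n" using q by (simp add: r_def q_def)
      also have "r n * (q / sqrt (1 + q\<^sup>2)) = X n * q" using q by (simp add: r_def q_def)
      also have "X n * q = Y n" using elim by (simp add: q_def)
      finally have "r n *\<^sub>R dir (\<tau> n) = y n" using dir_decompose[of "y n" t] by (simp add: X_def Y_def)
      then show ?case using elim q by (simp add: r_def q_def)
    qed
  qed
  ultimately show ?thesis using that by blast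
qed

lemma mass_facts:
  assumes "mass \<mu>"
  shows "prob_space \<mu>" "finite_measure \<mu>" "sets \<mu> = sets borel" "space \<mu> = UNIV"
  using assms sets_eq_imp_space_eq[of \<mu> borel]
  by (auto simp: mass_def prob_space.finite_measure)

lemma hyperplane_null:
  fixes a :: "real^2"
  assumes "mass \<mu>" "a \<noteq> 0"
  shows "{x. a \<bullet> x = b} \<in> null_sets \<mu>"
proof -
  interpret finite_measure \<mu> using mass_facts assms by blast
  have "affine {x. a \<bullet> x = b}" by (rule affine_hyperplane)
  moreover have "aff_dim {x. a \<bullet> x = b} = 1" using aff_dim_hyperplane[OF assms(2)] by simp
  ultimately have "measure \<mu> {x. a \<bullet> x = b} = 0" using assms by (auto simp: mass_def)
  moreover have "{x. a \<bullet> x = b} \<in> sets \<mu>"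
    by (simp add: mass_facts(3)[OF assms(1)] closed_hyperplane borel_closed)
  ultimately show ?thesis by (auto simp: emeasure_eq_measure)
qed

lemma line_through_null:
  assumes "mass \<mu>" shows "{x. (x - c) \<bullet> dir t = 0} \<in> null_sets \<mu>"
proof -
  have "{x. (x - c) \<bullet> dir t = 0} = {x. dir t \<bullet> x = dir t \<bullet> c}"
    by (auto simp: inner_diff_left inner_diff_right inner_commute)
  then show ?thesis using hyperplane_null[OF assms dir_nonzero] by simp
qed

text \<open>This is dominated convergence for indicator functions. It reduces every continuity statement about measures of
  wedges and half planes to a pointwise statement off finitely many lines.\<close>

lemma tendsto_measure_of_membership:
  assumes "finite_measure M" "\<And>n. A n \<in> sets M" "B \<in> sets M" "N \<in> null_sets M"
    and "\<And>x. x \<notin> N \<Longrightarrow> \<forall>\<^sub>F n in sequentially. x \<in> A n \<longleftrightarrow> x \<in> B"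
  shows "(\<lambda>n. measure M (A n)) \<longlonglongrightarrow> measure M B"
proof -
  interpret finite_measure M by fact
  have "(\<lambda>n. \<integral>x. indicator (A n) x \<partial>M) \<longlonglongrightarrow> (\<integral>x. indicator B x \<partial>M :: real)"
  proof (rule integral_dominated_convergence[where w = "\<lambda>_. 1"])
    show "AE x in M. (\<lambda>n. indicat_real (A n) x) \<longlonglongrightarrow> indicat_real B x"
    proof (rule AE_I'[OF assms(4)], safe)
      fix x assume *: "\<not> (\<lambda>n. indicat_real (A n) x) \<longlonglongrightarrow> indicat_real B x"
      show "x \<in> N"
      proof (rule ccontr)
        assume "x \<notin> N"
        from assms(5)[OF this] have "\<forall>\<^sub>F n in sequentially. indicat_real (A n) x = indicat_real B x"
          by eventually_elim (simp add: indicator_def)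
        then show False using * by (simp add: tendsto_eventually)
      qed
    qed
  qed (use assms(2,3) in \<open>auto simp: indicator_def\<close>)
  then show ?thesis using assms(2,3) by (simp add: sets.Int_space_eq2)
qed

lemma ray_eq: "sweep c a a = {x. (x - c) \<bullet> dir (a + pi/2) = 0 \<and> 0 \<le> (x - c) \<bullet> dir a}" (is "_ = ?R")
proof (intro set_eqI iffI)
  fix x assume "x \<in> sweep c a a"
  then show "x \<in> ?R"
    by (auto simp: mem_sweep inner_dir)
next
  fix x assume "x \<in> ?R"
  then have "x - c = ((x - c) \<bullet> dir a) *\<^sub>R dir a" using dir_decompose[of "x - c" a] by simp
  then have "x = c + ((x - c) \<bullet> dir a) *\<^sub>R dir a" by (simp add: algebra_simps)
  then show "x \<in> sweep c a a" using \<open>x \<in> ?R\<close> unfolding mem_sweep by blast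
qed

lemma sweep_closed:
  assumes "a \<le> b" "b \<le> a + 2 * pi" shows "closed (sweep c a b)"
proof -
  have 1: "closed (sweep c a b)" if "a < b" "b \<le> a + pi" for a b
    unfolding sweep_eq_halfplanes[OF that]
    by (intro closed_Collect_conj closed_Collect_le continuous_intros)
  show ?thesis
  proof (cases "a = b")
    case True
    show ?thesis unfolding True ray_eq
      by (intro closed_Collect_conj closed_Collect_le closed_Collect_eq continuous_intros)
  next
    case False
    have "sweep c a b = sweep c a ((a + b) / 2) \<union> sweep c ((a + b) / 2) b"
      using assms by (intro sweep_Un) auto
    then show ?thesis using False assms 1[of a "(a + b) / 2"] 1[of "(a + b) / 2" b] by (auto simp: field_simps)
  qed
qed

lemma sweep_sets:
  assumes "mass \<mu>" "a \<le> b" "b \<le> a + 2 * pi" shows "sweep c a b \<in> sets \<mu>"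
  using sweep_closed[OF assms(2,3)] by (simp add: mass_facts(3)[OF assms(1)] borel_closed)

lemma ray_null:
  assumes "mass \<mu>" shows "sweep c a a \<in> null_sets \<mu>"
  by (rule null_sets_subset[OF line_through_null[OF assms, of c "a + pi/2"]])
     (use sweep_sets[OF assms, of a a c] in \<open>auto simp: ray_eq\<close>)

lemma measure_ray [simp]: "mass \<mu> \<Longrightarrow> measure \<mu> (sweep c a a) = 0"
  using ray_null by (simp add: measure_eq_0_null_sets)

lemma measure_sweep_add:
  assumes "mass \<mu>" "a \<le> b" "b \<le> d" "d \<le> a + 2 * pi"
  shows "measure \<mu> (sweep c a d) = measure \<mu> (sweep c a b) + measure \<mu> (sweep c b d)"
proof -
  interpret finite_measure \<mu> using mass_facts assms by blast
  have "sweep c a b \<inter> sweep c b d \<subseteq> sweep c a a \<union> sweep c b b"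
  proof
    fix x assume x: "x \<in> sweep c a b \<inter> sweep c b d"
    then obtain t s where t: "a \<le> t" "t \<le> b" "0 \<le> s" "x = c + s *\<^sub>R dir t" by (auto simp: mem_sweep)
    consider "s = 0" | "t = a" | "t = b" | "0 < s" "a < t" "t < b" using t by force
    then show "x \<in> sweep c a a \<union> sweep c b b"
    proof cases
      case 4
      have "c + s *\<^sub>R dir (t + 2 * pi) \<in> sweep c b d" using x t by simp
      then have "t + 2 * pi \<le> d"
        using mem_sweep_polar[of s b "t + 2 * pi" d c] 4 assms by simp
      then show ?thesis using 4 assms by simp
    qed (use t in \<open>auto simp: mem_sweep\<close>)
  qed
  moreover have "sweep c a b \<inter> sweep c b d \<in> sets \<mu>"
    using sweep_sets[OF assms(1)] assms by (intro sets.Int) auto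
  ultimately have "sweep c a b \<inter> sweep c b d \<in> null_sets \<mu>"
    using null_sets_subset[OF null_sets.Un[OF ray_null ray_null]] assms(1) by blast
  then have "AE x in \<mu>. x \<notin> sweep c a b \<or> x \<notin> sweep c b d" by (rule AE_I') auto
  then have "measure \<mu> (sweep c a b \<union> sweep c b d) = measure \<mu> (sweep c a b) + measure \<mu> (sweep c b d)"
    using sweep_sets[OF assms(1)] assms by (intro measure_Un_AE) (auto simp: fmeasurable_eq_sets)
  then show ?thesis using assms sweep_Un[of a b d c] by simp
qed

text \<open>A point off the two limiting boundary rays has an angle strictly inside or strictly outside the limiting wedge, and
  keeps it under small changes of apex and rays. The degenerate limits, a single ray and the whole plane, are
  included; this lets the lemma serve both for intermediate values at the ends of the range and for limits of fans.\<close>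

lemma tendsto_measure_sweep:
  assumes "mass \<mu>" "c \<longlonglongrightarrow> c0" "a \<longlonglongrightarrow> a0" "b \<longlonglongrightarrow> b0" "\<And>n. a n \<le> b n" "\<And>n. b n \<le> a n + 2 * pi"
  shows "(\<lambda>n. measure \<mu> (sweep (c n) (a n) (b n))) \<longlonglongrightarrow> measure \<mu> (sweep c0 a0 b0)"
proof (rule tendsto_measure_of_membership)
  show "finite_measure \<mu>" using mass_facts assms by blast
  have ab: "a0 \<le> b0" by (rule LIMSEQ_le[OF assms(3,4)]) (use assms in auto)
  have ba: "b0 \<le> a0 + 2 * pi"
    by (rule LIMSEQ_le[OF assms(4) tendsto_add[OF assms(3) tendsto_const]]) (use assms in auto)
  show "sweep (c n) (a n) (b n) \<in> sets \<mu>" for n using sweep_sets assms by blast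
  show "sweep c0 a0 b0 \<in> sets \<mu>" using sweep_sets assms ab ba by blast
  show "sweep c0 a0 a0 \<union> sweep c0 b0 b0 \<in> null_sets \<mu>"
    using ray_null[OF assms(1)] by blast
  fix x assume x: "x \<notin> sweep c0 a0 a0 \<union> sweep c0 b0 b0"
  obtain \<rho> t where t: "0 \<le> \<rho>" "a0 \<le> t" "t < a0 + 2 * pi" "x - c0 = \<rho> *\<^sub>R dir t" by (rule polar_form)
  have x0: "x = c0 + \<rho> *\<^sub>R dir t" using t by (simp add: algebra_simps)
  have "\<rho> \<noteq> 0" "t \<noteq> a0" "t \<noteq> b0" using x t(1) unfolding x0 by (auto simp: mem_sweep)
  then have *: "0 < \<rho>" "a0 < t" using t by auto
  have "(\<lambda>n. x - c n) \<longlonglongrightarrow> \<rho> *\<^sub>R dir t"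
    unfolding t(4)[symmetric] by (intro tendsto_intros assms)
  then obtain \<tau> r where \<tau>: "\<tau> \<longlonglongrightarrow> t"
    and r: "\<forall>\<^sub>F n in sequentially. 0 < r n \<and> x - c n = r n *\<^sub>R dir (\<tau> n)"
    using local_polar_lift *(1) by blast
  have ev: "\<forall>\<^sub>F n in sequentially. u n < v n" if "u \<longlonglongrightarrow> u0" "v \<longlonglongrightarrow> v0" "u0 < v0" for u v :: "nat \<Rightarrow> real" and u0 v0
  proof -
    have "\<forall>\<^sub>F n in sequentially. 0 < v n - u n"
      by (rule order_tendstoD(1)[OF tendsto_diff[OF that(2,1)]]) (use that in simp)
    then show ?thesis by eventually_elim simp
  qed
  have e1: "\<forall>\<^sub>F n in sequentially. a n < \<tau> n" using ev[OF assms(3) \<tau> *(2)] .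
  have e2: "\<forall>\<^sub>F n in sequentially. \<tau> n < a n + 2 * pi"
    using ev[OF \<tau> tendsto_add[OF assms(3) tendsto_const]] t by blast
  have e3: "\<forall>\<^sub>F n in sequentially. \<tau> n \<le> b n \<longleftrightarrow> t \<le> b0"
  proof (cases "t \<le> b0")
    case True
    then have "t < b0" using \<open>t \<noteq> b0\<close> by simp
    from ev[OF \<tau> assms(4) this] show ?thesis by eventually_elim (use True in simp)
  next
    case False
    then have "b0 < t" by simp
    from ev[OF assms(4) \<tau> this] show ?thesis by eventually_elim (use False in simp)
  qed
  from r e1 e2 e3 show "\<forall>\<^sub>F n in sequentially. x \<in> sweep (c n) (a n) (b n) \<longleftrightarrow> x \<in> sweep c0 a0 b0"
  proof eventually_elim
    case (elim n)
    have "x = c n + r n *\<^sub>R dir (\<tau> n)" using elim(1) by (simp add: algebra_simps)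
    then have "x \<in> sweep (c n) (a n) (b n) \<longleftrightarrow> \<tau> n \<le> b n"
      using mem_sweep_polar[of "r n" "a n" "\<tau> n" "b n" "c n"] elim assms(6)[of n] by simp
    also have "\<dots> \<longleftrightarrow> t \<le> b0" by (rule elim)
    also have "\<dots> \<longleftrightarrow> x \<in> sweep c0 a0 b0"
      unfolding x0 using mem_sweep_polar[of \<rho> a0 t b0 c0] * t ba by simp
    finally show ?case .
  qed
qed

definition full_support :: "(real^2) measure \<Rightarrow> bool" where
  "full_support \<mu> \<longleftrightarrow> (\<forall>U. open U \<and> U \<noteq> {} \<longrightarrow> 0 < measure \<mu> U)"

lemma measure_sweep_pos:
  assumes "mass \<mu>" "full_support \<mu>" "a < b" "b \<le> a + 2 * pi"
  shows "0 < measure \<mu> (sweep c a b)"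
proof -
  interpret finite_measure \<mu> using mass_facts assms by blast
  define b' where "b' = min b (a + pi)"
  have b': "a < b'" "b' \<le> b" "b' \<le> a + pi" using assms by (auto simp: b'_def)
  define U where "U = {x. (x - c) \<bullet> dir (a + pi/2) > 0 \<and> (x - c) \<bullet> dir (b' + pi/2) < 0}"
  have "open U" unfolding U_def by (intro open_Collect_conj open_Collect_less continuous_intros)
  moreover have "c + dir ((a + b') / 2) \<in> U"
  proof -
    have "0 < sin ((b' - a) / 2)" by (rule sin_gt_zero) (use b' in auto)
    moreover have "dir ((a + b') / 2) \<bullet> dir (a + pi/2) = sin ((b' - a) / 2)"
      "dir ((a + b') / 2) \<bullet> dir (b' + pi/2) = - sin ((b' - a) / 2)"
      using cos_diff[of "(b' - a) / 2" "pi/2"] cos_diff[of "- ((b' - a) / 2)" "pi/2"]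
      by (simp_all add: inner_dir field_simps)
    ultimately show ?thesis by (simp add: U_def)
  qed
  ultimately have "0 < measure \<mu> U" using assms(2) by (auto simp: full_support_def)
  also have "measure \<mu> U \<le> measure \<mu> (sweep c a b)"
  proof (rule finite_measure_mono)
    have "U \<subseteq> sweep c a b'" unfolding sweep_eq_halfplanes[OF b'(1,3)] U_def by auto
    also have "\<dots> \<subseteq> sweep c a b" by (rule sweep_mono) (use b' in auto)
    finally show "U \<subseteq> sweep c a b" .
  qed (use sweep_sets assms in auto)
  finally show ?thesis .
qed

lemma measure_sweep_strict_mono:
  assumes "mass \<mu>" "full_support \<mu>" "a \<le> b" "b < d" "d \<le> a + 2 * pi"
  shows "measure \<mu> (sweep c a b) < measure \<mu> (sweep c a d)"
  using measure_sweep_add[of \<mu> a b d c] measure_sweep_pos[of \<mu> b d c] assms by simp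

section \<open>Equipartitioning fans and the obstruction\<close>

definition equi_fan :: "nat \<Rightarrow> (real^2) measure \<Rightarrow> real^2 \<Rightarrow> (nat \<Rightarrow> real) \<Rightarrow> bool" where
  "equi_fan q \<mu> c \<theta> \<longleftrightarrow> fan_angles q \<theta> \<and> (\<forall>i. measure \<mu> (sweep c (\<theta> i) (\<theta> (Suc i))) = 1 / real q)"

definition narrow :: "nat \<Rightarrow> (nat \<Rightarrow> real) \<Rightarrow> bool" where
  "narrow p \<theta> \<longleftrightarrow> (\<forall>i. \<theta> (i + p) \<le> \<theta> i + pi)"

lemma fan_less_iff: "fan_angles q \<theta> \<Longrightarrow> \<theta> i < \<theta> j \<longleftrightarrow> i < j"
  using strict_mono_less[of \<theta> i j] by (simp add: fan_angles_def strict_mono_Suc_iff)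

lemma fan_le_iff: "fan_angles q \<theta> \<Longrightarrow> \<theta> i \<le> \<theta> j \<longleftrightarrow> i \<le> j"
  using fan_less_iff[of q \<theta> j i] by (simp add: linorder_not_less [symmetric])

lemma fan_shift: "fan_angles q \<theta> \<Longrightarrow> \<theta> (i + k * q) = \<theta> i + 2 * pi * real k"
proof (induction k)
  case (Suc k)
  have "\<theta> (i + Suc k * q) = \<theta> (i + k * q + q)" by (simp add: algebra_simps)
  also have "\<dots> = \<theta> (i + k * q) + 2 * pi" using Suc.prems unfolding fan_angles_def by blast
  finally show ?case using Suc by (simp add: algebra_simps)
qed simp

lemma fan_period: "fan_angles q \<theta> \<Longrightarrow> \<theta> (i + q) = \<theta> i + 2 * pi"
  by (simp add: fan_angles_def)

lemma fan_width: "fan_angles q \<theta> \<Longrightarrow> n \<le> q \<Longrightarrow> \<theta> (i + n) \<le> \<theta> i + 2 * pi"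
  using fan_le_iff[of q \<theta> "i + n" "i + q"] fan_period[of q \<theta> i] by simp

lemma fan_unbounded:
  assumes "fan_angles q \<theta>" obtains N where "x < \<theta> N"
proof -
  obtain k where "(x - \<theta> 0) / (2 * pi) < real k" using reals_Archimedean2 by blast
  then have "x < \<theta> (0 + k * q)" unfolding fan_shift[OF assms] by (simp add: field_simps)
  then show ?thesis by (rule that)
qed

text \<open>Fans are indexed by natural numbers, so a direction has to be turned by full circles until it lies past the ray of
  index \<open>0\<close>.\<close>

lemma fan_locate:
  assumes "fan_angles q \<theta>"
  obtains k m where "\<theta> m \<le> x + 2 * pi * real k" "x + 2 * pi * real k < \<theta> (Suc m)"
proof -
  obtain k where "(\<theta> 0 - x) / (2 * pi) < real k" using reals_Archimedean2 by blast
  then have k: "\<theta> 0 < x + 2 * pi * real k" by (simp add: field_simps)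
  define y where "y = x + 2 * pi * real k"
  define n where "n = (LEAST n. y < \<theta> n)"
  obtain N where "y < \<theta> N" using fan_unbounded[OF assms] .
  then have n: "y < \<theta> n" unfolding n_def by (rule LeastI)
  with k have "n \<noteq> 0" by (intro notI) (simp add: y_def)
  then obtain m where m: "n = Suc m" using not0_implies_Suc by blast
  then have "\<not> y < \<theta> m" unfolding n_def by (intro not_less_Least) simp
  then show ?thesis using that[of m k] n m by (simp add: y_def)
qed

lemma equi_fan_measure:
  assumes "mass \<mu>" "equi_fan q \<mu> c \<theta>" "n \<le> q"
  shows "measure \<mu> (sweep c (\<theta> i) (\<theta> (i + n))) = real n / real q"
  using assms(3)
proof (induction n)
  case (Suc n)
  have fan: "fan_angles q \<theta>" using assms by (simp add: equi_fan_def)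
  have "measure \<mu> (sweep c (\<theta> i) (\<theta> (i + Suc n)))
    = measure \<mu> (sweep c (\<theta> i) (\<theta> (i + n))) + measure \<mu> (sweep c (\<theta> (i + n)) (\<theta> (i + Suc n)))"
    using Suc fan fan_width[OF fan, of "Suc n" i]
    by (intro measure_sweep_add assms(1)) (simp_all add: fan_le_iff)
  also have "\<dots> = real n / real q + 1 / real q" using Suc assms(2) by (simp add: equi_fan_def)
  finally show ?case by (simp add: add_divide_distrib)
qed (use assms in simp)

lemma equi_fan_admits:
  assumes "mass \<mu>" "0 < p" "p < q" "equi_fan q \<mu> c \<theta>" "narrow p \<theta>"
  shows "admits_convex_spiral_equicovering q p \<mu>"
proof -
  have fan: "fan_angles q \<theta>" using assms by (simp add: equi_fan_def)
  have "convex (r_wedge p c \<theta> i)" for i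
    unfolding r_wedge_def using assms fan by (intro convex_sweep) (auto simp: narrow_def fan_less_iff)
  moreover have "measure \<mu> (r_wedge p c \<theta> i) = real p / real q" for i
    unfolding r_wedge_def using assms by (intro equi_fan_measure) auto
  ultimately have "convex_spiral_equicovering q p \<mu> (r_wedge p c \<theta>)"
    using fan assms unfolding convex_spiral_equicovering_def convex_spiral_def spiral_def by blast
  then show ?thesis unfolding admits_convex_spiral_equicovering_def by blast
qed

lemma periodic_coprime_constant:
  fixes f :: "nat \<Rightarrow> 'a"
  assumes "coprime p q" "0 < q" "\<And>i. f (i + p) = f i" "\<And>i. f (i + q) = f i"
  shows "f i = f 0"
proof -
  have mult: "f (i + k * n) = f i" if "\<And>i. f (i + n) = f i" for i k n
    by (induction k) (simp_all add: that add.assoc [symmetric] add.commute[of n])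
  show ?thesis
  proof (cases "p = 0")
    case True
    then have "q = 1" using assms(1) by simp
    then show ?thesis using mult[OF assms(4), of 0 i] by simp
  next
    case False
    then obtain x y where "p * x = q * y + gcd p q" using bezout_nat by blast
    then have "p * x * i = q * y * i + i" using assms(1) by (simp add: algebra_simps)
    then have "0 + (x * i) * p = i + (y * i) * q" by (simp add: ac_simps)
    then show ?thesis using mult[OF assms(3), of 0 "x * i"] mult[OF assms(4), of i "y * i"] by simp
  qed
qed

text \<open>Moving a \<open>p\<close>-wedge on by one ray adds one elementary wedge and removes another, so the elementary measures have
  period \<open>p\<close>; they also have period \<open>q\<close>, hence are constant.\<close>

lemma admits_equi_fan:
  assumes \<mu>: "mass \<mu>" and pq: "coprime p q" "0 < p" "p < q"
    and adm: "admits_convex_spiral_equicovering q p \<mu>"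
  obtains c \<theta> where "equi_fan q \<mu> c \<theta>" "narrow p \<theta>"
proof -
  from adm obtain W where "convex_spiral_equicovering q p \<mu> W"
    by (auto simp: admits_convex_spiral_equicovering_def)
  then have "spiral q p W" and W0: "\<forall>i\<in>{1..q}. convex (W i) \<and> measure \<mu> (W i) = real p / real q"
    unfolding convex_spiral_equicovering_def convex_spiral_def by blast+
  then obtain c \<theta> where fan: "fan_angles q \<theta>" and W1: "\<forall>i\<in>{1..q}. W i = r_wedge p c \<theta> i"
    unfolding spiral_def by blast
  have W: "convex (r_wedge p c \<theta> i) \<and> measure \<mu> (r_wedge p c \<theta> i) = real p / real q" if "i \<in> {1..q}" for i
    using W0 W1 that by force
  have per: "r_wedge p c \<theta> (i + q) = r_wedge p c \<theta> i" for i
    using sweep_shift[of c "\<theta> i" 1 "\<theta> (i + p)"] fan_period[OF fan, of i] fan_period[OF fan, of "i + p"]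
    by (simp add: r_wedge_def ac_simps)
  have all: "convex (r_wedge p c \<theta> i) \<and> measure \<mu> (r_wedge p c \<theta> i) = real p / real q" for i
  proof (induction i rule: less_induct)
    case (less i)
    consider "i = 0" | "i \<in> {1..q}" | "q < i" by force
    then show ?case
    proof cases
      case 1 then show ?thesis using per[of 0] W[of q] pq by simp
    next
      case 3 then show ?thesis using per[of "i - q"] less[of "i - q"] pq by simp
    qed (use W in blast)
  qed
  have narrow: "narrow p \<theta>"
    unfolding narrow_def
  proof
    fix i
    show "\<theta> (i + p) \<le> \<theta> i + pi"
    proof (rule convex_sweep_imp_le_pi)
      show "convex (sweep c (\<theta> i) (\<theta> (i + p)))" using all[of i] by (simp add: r_wedge_def)
      show "\<theta> i \<le> \<theta> (i + p)" using fan by (simp add: fan_le_iff)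
      show "\<theta> (i + p) < \<theta> i + 2 * pi"
        using pq fan fan_less_iff[OF fan, of "i + p" "i + q"] by (simp add: fan_period)
    qed
  qed
  define f where "f i = measure \<mu> (sweep c (\<theta> i) (\<theta> (Suc i)))" for i
  have fp: "f (i + p) = f i" for i
  proof -
    have *: "\<theta> (i + Suc p) \<le> \<theta> i + 2 * pi" using fan_width[OF fan, of "Suc p" i] pq by simp
    have "f i + measure \<mu> (r_wedge p c \<theta> (Suc i)) = measure \<mu> (sweep c (\<theta> i) (\<theta> (i + Suc p)))"
      unfolding f_def r_wedge_def using fan * measure_sweep_add[OF \<mu>, of "\<theta> i" "\<theta> (Suc i)" "\<theta> (i + Suc p)" c]
      by (simp add: fan_le_iff)
    also have "\<dots> = measure \<mu> (r_wedge p c \<theta> i) + f (i + p)"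
      unfolding f_def r_wedge_def using fan * measure_sweep_add[OF \<mu>, of "\<theta> i" "\<theta> (i + p)" "\<theta> (i + Suc p)" c]
      by (simp add: fan_le_iff)
    finally show ?thesis using all by simp
  qed
  have fq: "f (i + q) = f i" for i
    using sweep_shift[of c "\<theta> i" 1 "\<theta> (Suc i)"] fan_period[OF fan, of i] fan_period[OF fan, of "Suc i"]
    unfolding f_def by (simp only: add_Suc of_int_1 mult_1_right)
  have f0: "f i = f 0" for i
    by (rule periodic_coprime_constant[of p q, OF pq(1) _ fp fq]) (use pq in simp)
  have sum: "measure \<mu> (sweep c (\<theta> 0) (\<theta> n)) = real n * f 0" if "n \<le> q" for n
    using that
  proof (induction n)
    case (Suc n)
    then have "measure \<mu> (sweep c (\<theta> 0) (\<theta> (Suc n))) = measure \<mu> (sweep c (\<theta> 0) (\<theta> n)) + f n"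
      unfolding f_def using fan fan_width[OF fan, of "Suc n" 0]
      by (intro measure_sweep_add \<mu>) (simp_all add: fan_le_iff)
    then show ?case using Suc f0[of n] by (simp add: algebra_simps)
  qed (use \<mu> in simp)
  have "real p * f 0 = real p / real q"
    using sum[of p] all[of 0] pq by (simp add: r_wedge_def)
  then have "f 0 = 1 / real q" using pq by (simp add: field_simps)
  then have "equi_fan q \<mu> c \<theta>" using fan f0 by (auto simp: equi_fan_def f_def)
  then show ?thesis using narrow that by blast
qed

text \<open>If \<open>\<theta> m\<close> is the last ray before the half plane begins, then narrowness puts the \<open>p - 1\<close> wedges after the next ray
  inside the half plane.\<close>

lemma equi_fan_depth:
  assumes \<mu>: "mass \<mu>" and pq: "0 < p" "p \<le> q" and fan: "equi_fan q \<mu> c \<theta>" "narrow p \<theta>"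
  shows "(real p - 1) / real q \<le> measure \<mu> (sweep c \<phi> (\<phi> + pi))"
proof -
  interpret finite_measure \<mu> using mass_facts \<mu> by blast
  have fan': "fan_angles q \<theta>" using fan by (simp add: equi_fan_def)
  obtain k m where m: "\<theta> m \<le> \<phi> + 2 * pi * real k" "\<phi> + 2 * pi * real k < \<theta> (Suc m)"
    using fan_locate[OF fan'] .
  have "(real p - 1) / real q = measure \<mu> (sweep c (\<theta> (Suc m)) (\<theta> (Suc m + (p - 1))))"
    using pq by (subst equi_fan_measure[OF \<mu> fan(1)]) (auto simp: of_nat_diff)
  also have "Suc m + (p - 1) = m + p" using pq by simp
  also have "measure \<mu> (sweep c (\<theta> (Suc m)) (\<theta> (m + p)))
    \<le> measure \<mu> (sweep c (\<phi> + 2 * pi * real k) (\<phi> + pi + 2 * pi * real k))"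
  proof (rule finite_measure_mono[OF sweep_mono])
    have "\<theta> (m + p) \<le> \<theta> m + pi" using fan(2) by (simp add: narrow_def)
    then show "\<theta> (m + p) \<le> \<phi> + pi + 2 * pi * real k" using m by simp
  qed (use m sweep_sets[OF \<mu>] in auto)
  also have "\<dots> = measure \<mu> (sweep c \<phi> (\<phi> + pi))"
    using sweep_shift[of c \<phi> "int k" "\<phi> + pi"] by simp
  finally show ?thesis .
qed

lemma narrow_imp_le_half:
  assumes "fan_angles q \<theta>" "narrow p \<theta>" shows "2 * p \<le> q"
proof -
  have "\<theta> (0 + p + p) \<le> \<theta> (0 + p) + pi" "\<theta> (0 + p) \<le> \<theta> 0 + pi"
    using assms(2) unfolding narrow_def by blast+
  then have "\<theta> (p + p) \<le> \<theta> (0 + q)" unfolding fan_period[OF assms(1)] by simp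
  then show ?thesis using assms(1) by (simp add: fan_le_iff)
qed

lemma affine_line_null_lborel:
  fixes L :: "(real^2) set"
  assumes "affine L" "aff_dim L = 1"
  shows "L \<in> null_sets lborel"
proof -
  have hull: "L = affine hull L" using assms by (metis affine_hull_eq)
  have "aff_dim L = int (DIM(real^2) - 1)" using assms by simp
  then have "\<exists>a b. a \<noteq> 0 \<and> affine hull L = {x. a \<bullet> x = b}" by (rule iffD1[OF aff_dim_eq_hyperplane])
  then obtain a b where ab: "a \<noteq> 0" "affine hull L = {x. a \<bullet> x = b}" by (elim exE conjE)
  have L_eq: "L = {x. a \<bullet> x = b}" by (rule trans[OF hull ab(2)])
  show ?thesis
    unfolding L_eq using negligible_hyperplane[of a b] ab(1)
    by (simp add: negligible_iff_null_sets null_sets_completion_iff closed_hyperplane borel_closed)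
qed

text \<open>The mass is uniform on three discs. The three functionals \<open>x\<close>, \<open>y\<close> and \<open>- x - y\<close> sum to zero, and each is large on
  one disc only; on the other two they are at most \<open>-3/4\<close>, \<open>-3/4\<close> and \<open>-1/2\<close>. As these bounds have a
  negative sum, at any point some functional exceeds its bound, and its upper half plane meets a single disc.\<close>

lemma measure_halfplane_le_third:
  obtains \<mu> where "mass \<mu>" "\<And>c. \<exists>\<phi>. measure \<mu> (sweep c \<phi> (\<phi> + pi)) \<le> 1 / 3"
proof -
  define B :: "real \<Rightarrow> real \<Rightarrow> (real^2) set" where "B x y = cball (vector [x, y]) (1/4)" for x y
  define S where "S = B 2 (-1) \<union> B (-1) 2 \<union> B (-1) (-1)"
  define \<mu> where "\<mu> = uniform_measure lborel S"
  define v where "v = measure lborel (B 0 0)"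
  have B_lm: "B x y \<in> fmeasurable lborel" for x y
    unfolding B_def by (intro fmeasurableI emeasure_bounded_finite) auto
  have vB: "measure lborel (B x y) = v" for x y
    unfolding B_def v_def by (simp add: content_cball)
  have v: "0 < v" unfolding v_def B_def by (rule content_cball_pos) simp
  have comp: "\<bar>z$1 - x\<bar> \<le> 1/4 \<and> \<bar>z$2 - y\<bar> \<le> 1/4" if "z \<in> B x y" for x y z
  proof -
    have "norm (z - vector [x, y]) \<le> 1/4" using that by (simp add: B_def dist_norm norm_minus_commute)
    then have "\<bar>(z - vector [x, y]) $ i\<bar> \<le> 1/4" for i using component_le_norm_cart[of "z - vector [x, y]" i] by linarith
    from this[of 1] this[of 2] show ?thesis by simp
  qed
  have disj: "B 2 (-1) \<inter> B (-1) 2 = {}" "(B 2 (-1) \<union> B (-1) 2) \<inter> B (-1) (-1) = {}"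
    by (auto dest!: comp)
  have mS: "measure lborel S = 3 * v"
    unfolding S_def using disj by (simp add: measure_Un3 B_lm fmeasurable.Un measure_Un2 vB)
  have Sfin: "S \<in> fmeasurable lborel" unfolding S_def by (intro fmeasurable.Un B_lm)
  have eS: "emeasure lborel S = ennreal (3 * v)" using Sfin mS by (metis emeasure_eq_measure2 fmeasurableD2 )
  have meas: "measure \<mu> A = measure lborel (S \<inter> A) / (3 * v)" if "A \<in> sets borel" for A
    unfolding \<mu>_def by (subst measure_uniform_measure) (use that eS mS v in auto)
  have "mass \<mu>"
    unfolding mass_def
  proof (intro conjI allI impI)
    show "prob_space \<mu>" unfolding \<mu>_def by (rule prob_space_uniform_measure) (use eS v in auto)
    show "sets \<mu> = sets borel" by (simp add: \<mu>_def)
    fix L :: "(real^2) set" assume L: "affine L \<and> aff_dim L = 1"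
    then have "L \<in> null_sets lborel" using affine_line_null_lborel by blast
    then have "S \<inter> L \<in> null_sets lborel" using Sfin by (intro null_set_Int1) (auto simp: fmeasurableD)
    then show "measure \<mu> L = 0"
      using \<open>L \<in> null_sets lborel\<close> by (subst meas) (auto simp: measure_eq_0_null_sets)
  qed
  moreover have "\<exists>\<phi>. measure \<mu> (sweep c \<phi> (\<phi> + pi)) \<le> 1 / 3" for c
  proof -
    have key: "\<exists>\<phi>. measure \<mu> (sweep c \<phi> (\<phi> + pi)) \<le> 1 / 3"
      if "u \<noteq> 0" "\<And>z. z \<in> S \<Longrightarrow> u \<bullet> c \<le> u \<bullet> z \<Longrightarrow> z \<in> B x y" for u :: "real^2" and x y
    proof -
      obtain \<rho> t where t: "0 \<le> \<rho>" "u = \<rho> *\<^sub>R dir t" using polar_form by metis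
      then have "0 < \<rho>" using that(1) by (cases "\<rho> = 0") auto
      have cl: "closed (sweep c (t - pi/2) (t - pi/2 + pi))" by (rule sweep_closed) auto
      have "S \<inter> sweep c (t - pi/2) (t - pi/2 + pi) \<subseteq> B x y"
        unfolding sweep_halfplane using that(2) \<open>0 < \<rho>\<close> t(2)
        by (auto simp: inner_diff_left inner_diff_right inner_commute)
      then have "measure lborel (S \<inter> sweep c (t - pi/2) (t - pi/2 + pi)) \<le> measure lborel (B x y)"
        by (intro measure_mono_fmeasurable B_lm) (use cl Sfin in auto)
      then have "measure lborel (S \<inter> sweep c (t - pi/2) (t - pi/2 + pi)) \<le> v" by (simp add: vB)
      then show ?thesis using cl v by (intro exI[of _ "t - pi/2"], subst meas) (auto simp: field_simps)
    qed
    have ip: "vector [a, b] \<bullet> z = a * z$1 + b * z$2" for a b :: real and z :: "real^2"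
      by (simp add: inner_vec_def sum_2)
    have nz: "(vector [1, 0] :: real^2) \<noteq> 0" "(vector [0, 1] :: real^2) \<noteq> 0" "(vector [-1, -1] :: real^2) \<noteq> 0"
      by (simp_all add: vec_eq_iff forall_2)
    \<comment> \<open>Otherwise the three functionals would have a negative sum at c.\<close>
    consider "c$1 > -3/4" | "c$2 > -3/4" | "c$1 + c$2 < 1/2" by linarith
    then show ?thesis
    proof cases
      case 1
      show ?thesis
        by (rule key[of "vector [1, 0]" 2 "-1"]) (use 1 nz in \<open>auto simp: S_def ip dest!: comp\<close>)
    next
      case 2
      show ?thesis
        by (rule key[of "vector [0, 1]" "-1" 2]) (use 2 nz in \<open>auto simp: S_def ip dest!: comp\<close>)
    next
      case 3
      show ?thesis
        by (rule key[of "vector [-1, -1]" "-1" "-1"]) (use 3 nz in \<open>auto simp: S_def ip dest!: comp\<close>)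
    qed
  qed
  ultimately show ?thesis using that by blast
qed

theorem no_equicovering:
  assumes "0 < p" "p < q" "coprime p q" "q < 2 * p \<or> q < 3 * p - 3"
  shows "\<exists>\<mu>. mass \<mu> \<and> \<not> admits_convex_spiral_equicovering q p \<mu>"
proof -
  obtain \<mu> where \<mu>: "mass \<mu>" "\<And>c. \<exists>\<phi>. measure \<mu> (sweep c \<phi> (\<phi> + pi)) \<le> 1 / 3"
    using measure_halfplane_le_third by blast
  have "\<not> admits_convex_spiral_equicovering q p \<mu>"
  proof
    assume "admits_convex_spiral_equicovering q p \<mu>"
    then obtain c \<theta> where fan: "equi_fan q \<mu> c \<theta>" "narrow p \<theta>"
      using admits_equi_fan[OF \<mu>(1) assms(3,1,2)] by blast
    have "2 * p \<le> q" using fan narrow_imp_le_half by (auto simp: equi_fan_def)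
    then have q: "q < 3 * p - 3" using assms by simp
    obtain \<phi> where "measure \<mu> (sweep c \<phi> (\<phi> + pi)) \<le> 1 / 3" using \<mu> by blast
    then have "(real p - 1) / real q \<le> 1 / 3"
      using equi_fan_depth[OF \<mu>(1) assms(1) less_imp_le[OF assms(2)] fan, of \<phi>] by (rule order_trans[rotated])
    then have "real p - 1 \<le> 1 / 3 * real q" using assms by (simp only: pos_divide_le_eq of_nat_0_less_iff)
    then show False using q by linarith
  qed
  then show ?thesis using \<mu> by blast
qed

section \<open>Existence above the threshold: moving the apex\<close>

text \<open>A parametrized equation with a strictly increasing left-hand side has a continuous solution, as soon as
  the left-hand side is continuous in the parameter for each fixed value of the unknown. The rays of a fan, the offsets of
  halving lines and the angles between them are all obtained in this way.\<close>

lemma continuous_on_root: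
  fixes \<tau> :: "'a::topological_space \<Rightarrow> real" and g :: "'a \<Rightarrow> real \<Rightarrow> real"
  assumes \<tau>: "\<And>x. l < \<tau> x \<and> \<tau> x < u" "\<And>x. g x (\<tau> x) = s"
    and mono: "\<And>x t t'. l < t \<Longrightarrow> t < t' \<Longrightarrow> t' < u \<Longrightarrow> g x t < g x t'"
    and cont: "\<And>t. l < t \<Longrightarrow> t < u \<Longrightarrow> continuous_on UNIV (\<lambda>x. g x t)"
  shows "continuous_on UNIV \<tau>"
  unfolding continuous_on_def
proof
  fix x0
  have le: "t \<le> t' \<Longrightarrow> l < t \<Longrightarrow> t' < u \<Longrightarrow> g x t \<le> g x t'" for x t t'
    using mono[of t t' x] by (cases "t = t'") auto
  have lim: "((\<lambda>x. g x t) \<longlongrightarrow> g x0 t) (at x0 within UNIV)" if "l < t" "t < u" for t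
    using cont[OF that] by (auto simp: continuous_on_def)
  show "(\<tau> \<longlongrightarrow> \<tau> x0) (at x0 within UNIV)"
  proof (rule order_tendstoI)
    fix y assume y: "y < \<tau> x0"
    define t where "t = max y ((l + \<tau> x0) / 2)"
    have t: "y \<le> t" "l < t" "t < \<tau> x0" "t < u" using y \<tau>(1)[of x0] by (auto simp: t_def max_def)
    have "g x0 t < s" using mono[of t "\<tau> x0" x0] t \<tau>[of x0] by simp
    then have "\<forall>\<^sub>F x in at x0 within UNIV. g x t < s" using order_tendstoD(2)[OF lim[OF t(2,4)]] by blast
    then show "\<forall>\<^sub>F x in at x0 within UNIV. y < \<tau> x"
      by eventually_elim (use le t \<tau> in \<open>metis linorder_not_less order_le_less_trans\<close>)
  next
    fix y assume y: "\<tau> x0 < y"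
    define t where "t = min y ((u + \<tau> x0) / 2)"
    have t: "t \<le> y" "l < t" "\<tau> x0 < t" "t < u" using y \<tau>(1)[of x0] by (auto simp: t_def min_def)
    have "s < g x0 t" using mono[of "\<tau> x0" t x0] t \<tau>[of x0] by simp
    then have "\<forall>\<^sub>F x in at x0 within UNIV. s < g x t" using order_tendstoD(1)[OF lim[OF t(2,4)]] by blast
    then show "\<forall>\<^sub>F x in at x0 within UNIV. \<tau> x < y"
      by eventually_elim (use le t \<tau> in \<open>metis linorder_not_less order_less_le_trans\<close>)
  qed
qed

text \<open>The definite description is meaningful for masses of full support and \<open>s\<close> between \<open>0\<close> and \<open>1\<close>.\<close>

definition split_angle :: "(real^2) measure \<Rightarrow> real \<Rightarrow> real \<Rightarrow> real^2 \<Rightarrow> real" where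
  "split_angle \<mu> a s c = (THE \<tau>. a \<le> \<tau> \<and> \<tau> \<le> a + 2 * pi \<and> measure \<mu> (sweep c a \<tau>) = s)"

lemma split_angle_ex1:
  assumes "mass \<mu>" "full_support \<mu>" "0 \<le> s" "s \<le> 1"
  shows "\<exists>!\<tau>. a \<le> \<tau> \<and> \<tau> \<le> a + 2 * pi \<and> measure \<mu> (sweep c a \<tau>) = s"
proof -
  interpret prob_space \<mu> using mass_facts assms by blast
  have "continuous_on {a..a + 2 * pi} (\<lambda>\<tau>. measure \<mu> (sweep c a \<tau>))"
    unfolding continuous_on_sequentially comp_def
    by (auto intro!: tendsto_measure_sweep[OF assms(1)])
  moreover have "measure \<mu> (sweep c a a) \<le> s" "s \<le> measure \<mu> (sweep c a (a + 2 * pi))"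
    using assms prob_space by (simp_all add: sweep_full mass_facts(4))
  ultimately have "\<exists>\<tau>. a \<le> \<tau> \<and> \<tau> \<le> a + 2 * pi \<and> measure \<mu> (sweep c a \<tau>) = s"
    by (intro IVT') auto
  moreover have "\<tau> = \<tau>'"
    if "a \<le> \<tau>" "\<tau> \<le> a + 2 * pi" "measure \<mu> (sweep c a \<tau>) = s"
      "a \<le> \<tau>'" "\<tau>' \<le> a + 2 * pi" "measure \<mu> (sweep c a \<tau>') = s" for \<tau> \<tau>'
    using that measure_sweep_strict_mono[OF assms(1,2), of a \<tau> \<tau>' c]
      measure_sweep_strict_mono[OF assms(1,2), of a \<tau>' \<tau> c] by (cases \<tau> \<tau>' rule: linorder_cases) auto
  ultimately show ?thesis by blast
qed

lemma split_angle:
  assumes "mass \<mu>" "full_support \<mu>" "0 \<le> s" "s \<le> 1"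
  shows "a \<le> split_angle \<mu> a s c" "split_angle \<mu> a s c \<le> a + 2 * pi"
    "measure \<mu> (sweep c a (split_angle \<mu> a s c)) = s"
  using theI'[OF split_angle_ex1[OF assms, of a c]] by (simp_all add: split_angle_def)

lemma split_angle_unique:
  assumes "mass \<mu>" "full_support \<mu>" "a \<le> \<tau>" "\<tau> \<le> a + 2 * pi"
  shows "split_angle \<mu> a (measure \<mu> (sweep c a \<tau>)) c = \<tau>"
proof -
  interpret prob_space \<mu> using mass_facts assms by blast
  show ?thesis unfolding split_angle_def
    by (rule the1_equality[OF split_angle_ex1]) (use assms in auto)
qed

lemma split_angle_0_1:
  assumes "mass \<mu>" "full_support \<mu>"
  shows "split_angle \<mu> a 0 c = a" "split_angle \<mu> a 1 c = a + 2 * pi"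
proof -
  interpret prob_space \<mu> using mass_facts assms by blast
  show "split_angle \<mu> a 0 c = a" "split_angle \<mu> a 1 c = a + 2 * pi"
    using split_angle_unique[OF assms, of a a c] split_angle_unique[OF assms, of a "a + 2 * pi" c] assms prob_space
    by (simp_all add: sweep_full mass_facts(4))
qed

lemma split_angle_strict_mono:
  assumes "mass \<mu>" "full_support \<mu>" "0 \<le> s" "s < s'" "s' \<le> 1"
  shows "split_angle \<mu> a s c < split_angle \<mu> a s' c"
proof (rule ccontr)
  assume *: "\<not> split_angle \<mu> a s c < split_angle \<mu> a s' c"
  have "s' \<le> s"
    using measure_sweep_strict_mono[OF assms(1,2), of a "split_angle \<mu> a s' c" "split_angle \<mu> a s c" c] *
      split_angle[OF assms(1,2), where s = s and a = a and c = c]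
      split_angle[OF assms(1,2), where s = s' and a = a and c = c] assms(3-5)
    by (cases "split_angle \<mu> a s' c = split_angle \<mu> a s c") auto
  then show False using assms by simp
qed

lemma continuous_split_angle:
  assumes "mass \<mu>" "full_support \<mu>" "0 \<le> s" "s \<le> 1"
  shows "continuous_on UNIV (split_angle \<mu> a s)"
proof -
  consider "s = 0" | "s = 1" | "0 < s" "s < 1" using assms by linarith
  then show ?thesis
  proof cases
    case 3
    show ?thesis
    proof (rule continuous_on_root[where l = a and u = "a + 2 * pi" and s = s and g = "\<lambda>c t. measure \<mu> (sweep c a t)"])
      show "a < split_angle \<mu> a s c \<and> split_angle \<mu> a s c < a + 2 * pi" for c
        using split_angle_strict_mono[OF assms(1,2), of 0 s a c] split_angle_strict_mono[OF assms(1,2), of s 1 a c] 3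
          split_angle_0_1[OF assms(1,2), of a c] by simp
      show "continuous_on UNIV (\<lambda>c. measure \<mu> (sweep c a t))" if "a < t" "t < a + 2 * pi" for t
        unfolding continuous_on_sequentially comp_def
        using that by (auto intro!: tendsto_measure_sweep[OF assms(1)])
    qed (use split_angle[OF assms] measure_sweep_strict_mono[OF assms(1,2)] in auto)
  qed (use split_angle_0_1[OF assms(1,2)] in auto)
qed

text \<open>The fan at \<open>c\<close> that starts in direction \<open>a\<close> and cuts the mass into \<open>q\<close> equal parts, lifted to all indices.\<close>

definition measure_fan :: "(real^2) measure \<Rightarrow> nat \<Rightarrow> real \<Rightarrow> real^2 \<Rightarrow> nat \<Rightarrow> real" where
  "measure_fan \<mu> q a c j = 2 * pi * real (j div q) + split_angle \<mu> a (real (j mod q) / real q) c"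

lemma continuous_measure_fan:
  assumes "mass \<mu>" "full_support \<mu>" "0 < q"
  shows "continuous_on UNIV (\<lambda>c. measure_fan \<mu> q a c j)"
  unfolding measure_fan_def
  by (intro continuous_intros continuous_split_angle assms) (use assms(3) in \<open>auto simp: divide_le_eq\<close>)

lemma equi_fan_measure_fan:
  assumes "mass \<mu>" "full_support \<mu>" "0 < q"
  shows "equi_fan q \<mu> c (measure_fan \<mu> q a c)"
proof -
  let ?T = "\<lambda>i. split_angle \<mu> a (real i / real q) c"
  have Suc: "measure_fan \<mu> q a c (Suc j) = 2 * pi * real (j div q) + ?T (Suc (j mod q))" for j
  proof (cases "Suc (j mod q) = q")
    case True
    then show ?thesis using split_angle_0_1[OF assms(1,2), of a c] assms(3)
      by (simp add: measure_fan_def mod_Suc div_Suc algebra_simps)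
  next
    case False
    then show ?thesis by (simp add: measure_fan_def mod_Suc div_Suc)
  qed
  have lt: "?T i < ?T (Suc i)" if "i < q" for i
    by (rule split_angle_strict_mono) (use that assms in \<open>auto simp: field_simps\<close>)
  have mes: "measure \<mu> (sweep c (?T i) (?T (Suc i))) = 1 / real q" if "i < q" for i
  proof -
    have "measure \<mu> (sweep c a (?T (Suc i))) = measure \<mu> (sweep c a (?T i)) + measure \<mu> (sweep c (?T i) (?T (Suc i)))"
      using that lt[OF that] split_angle(1)[OF assms(1,2), of "real i / real q" a c]
        split_angle(2)[OF assms(1,2), of "real (Suc i) / real q" a c]
      by (intro measure_sweep_add assms) auto
    moreover have "measure \<mu> (sweep c a (?T (Suc i))) = real (Suc i) / real q" "measure \<mu> (sweep c a (?T i)) = real i / real q"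
      by (rule split_angle[OF assms(1,2)]; use that in \<open>simp add: divide_le_eq\<close>)+
    ultimately show ?thesis by (simp add: add_divide_distrib)
  qed
  have "measure_fan \<mu> q a c j < measure_fan \<mu> q a c (Suc j)" for j
    unfolding Suc using lt[of "j mod q"] assms(3) by (simp add: measure_fan_def)
  moreover have "measure_fan \<mu> q a c (j + q) = measure_fan \<mu> q a c j + 2 * pi" for j
    using assms(3) by (simp add: measure_fan_def algebra_simps)
  moreover have "measure \<mu> (sweep c (measure_fan \<mu> q a c j) (measure_fan \<mu> q a c (Suc j))) = 1 / real q" for j
    using sweep_shift[of c "?T (j mod q)" "int (j div q)" "?T (Suc (j mod q))"] mes[of "j mod q"] assms(3)
    unfolding Suc by (simp add: measure_fan_def add.commute)
  ultimately show ?thesis by (auto simp: equi_fan_def fan_angles_def)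
qed

text \<open>A wedge of angle \<open>\<gamma>\<close> with \<open>\<pi> < \<gamma> < 2\<pi>\<close> contributes a vector of length \<open>- cos (\<gamma> / 2)\<close> pointing away from it
  along its bisector, any smaller wedge contributes zero; so the sum depends continuously on the fan.\<close>

definition pull :: "nat \<Rightarrow> nat \<Rightarrow> (nat \<Rightarrow> real) \<Rightarrow> real^2" where
  "pull p q \<theta> = (\<Sum>i<q. min 0 (cos ((\<theta> (i + p) - \<theta> i) / 2)) *\<^sub>R dir ((\<theta> i + \<theta> (i + p)) / 2))"

text \<open>Here \<open>\<kappa> dir \<psi>\<close> stands for an outward force, and the half plane facing \<open>\<psi>\<close> fits into the
  wedge of index \<open>l\<close>. Suppose that the pulls add up to it. Let \<open>j\<close> be the last bad wedge whose bisector does not come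
  after \<open>\<psi> + \<pi>\<close>, and \<open>k\<close> the first one whose bisector does not come before. If their bisectors were more than \<open>\<pi>\<close>
  apart, all bisectors and \<open>\<psi>\<close> would lie in an open half plane and could not cancel. Therefore the
  wedges \<open>l\<close>, \<open>j\<close>, \<open>k\<close> and again \<open>l\<close>, each of angle at least \<open>\<pi>\<close>, have bisectors at most \<open>\<pi>\<close> apart (with \<open>\<psi>\<close>
  in place of the bisector of \<open>l\<close>), and consecutive ones overlap. In terms of indices \<open>j < l + p\<close>, \<open>k < j + p\<close> and \<open>l + q < k + p\<close>; adding up gives \<open>q + 3 \<le> 3p\<close>.
  With \<open>\<kappa> = 0\<close> the direction \<open>\<psi>\<close> may be the bisector of any bad wedge.\<close>

lemma pull_ne_outward:
  assumes fan: "fan_angles q \<theta>" and pq: "0 < p" "p < q" "3 * p < q + 3"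
    and bad: "\<theta> i0 + pi < \<theta> (i0 + p)"
    and l: "2 * q \<le> l" "\<theta> l + pi/2 \<le> \<psi>" "\<psi> + pi/2 \<le> \<theta> (l + p)"
    and "0 \<le> \<kappa>"
  shows "pull p q \<theta> \<noteq> \<kappa> *\<^sub>R dir \<psi>"
proof
  assume eq: "pull p q \<theta> = \<kappa> *\<^sub>R dir \<psi>"
  define bad where "bad i \<longleftrightarrow> \<theta> i + pi < \<theta> (i + p)" for i
  define M where "M i = (\<theta> i + \<theta> (i + p)) / 2" for i
  note less = fan_less_iff[OF fan] and le = fan_le_iff[OF fan]
  have M_less: "M i < M j \<longleftrightarrow> i < j" for i j
    using less[of i j] less[of "i + p" "j + p"] less[of j i] less[of "j + p" "i + p"]
    by (cases i j rule: linorder_cases) (auto simp: M_def)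
  have M_le: "M i \<le> M j \<longleftrightarrow> i \<le> j" for i j using M_less[of j i] by (auto simp: linorder_not_less [symmetric])
  have per: "\<theta> (i + n * q) = \<theta> i + 2 * pi * real n" for i n by (rule fan_shift[OF fan])
  have M_per: "M (i + n * q) = M i + 2 * pi * real n" for i n
    using per[of i n] per[of "i + p" n] by (simp add: M_def ac_simps)
  have bad_per: "bad (i + n * q) \<longleftrightarrow> bad i" for i n
    using per[of i n] per[of "i + p" n] by (simp add: bad_def ac_simps)
  have \<theta>M: "\<theta> i \<le> M i" "M i \<le> \<theta> (i + p)" for i using le[of i "i + p"] by (auto simp: M_def)
  have badM: "\<theta> i < M i - pi/2" "M i + pi/2 < \<theta> (i + p)" if "bad i" for i
    using that unfolding bad_def M_def by (simp_all add: field_simps)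
  define i1 where "i1 = i0 mod q"
  have i1: "bad i1" "i1 < q"
    using bad bad_per[of i1 "i0 div q"] pq by (simp_all add: i1_def bad_def)
  have small: "M i < \<psi>" if "i < q" for i
  proof -
    have "M i \<le> \<theta> (i + p)" by (rule \<theta>M)
    also have "\<dots> \<le> \<theta> l" unfolding le using that pq l by simp
    also have "\<dots> < \<psi>" using l pi_gt_zero by linarith
    finally show ?thesis .
  qed
  define J where "J = {i. bad i \<and> M i \<le> \<psi> + pi}"
  obtain N where "\<psi> + pi < \<theta> N" using fan_unbounded[OF fan] .
  have "J \<subseteq> {..<N}"
  proof
    fix i assume "i \<in> J"
    then have "\<theta> i < \<theta> N" using \<theta>M(1)[of i] \<open>\<psi> + pi < \<theta> N\<close> by (auto simp: J_def)
    then show "i \<in> {..<N}" by (simp add: less)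
  qed
  then have "finite J" using finite_subset by blast
  have "i1 \<in> J" using i1 small[of i1] pi_gt_zero unfolding J_def by (simp add: add_increasing2 less_imp_le)
  define j where "j = Max J"
  have j: "bad j" "M j \<le> \<psi> + pi"
    using Max_in[OF \<open>finite J\<close>] \<open>i1 \<in> J\<close> unfolding j_def J_def by blast+
  have j_max: "i \<le> j" if "bad i" "M i \<le> \<psi> + pi" for i
    unfolding j_def using Max_ge[OF \<open>finite J\<close>, of i] that by (simp add: J_def)
  define k where "k = (LEAST k. bad k \<and> \<psi> + pi \<le> M k)"
  have "\<exists>k. bad k \<and> \<psi> + pi \<le> M k"
  proof -
    have "N \<le> i1 + N * q" using pq by (simp add: trans_le_add2)
    then have "\<theta> N \<le> M (i1 + N * q)" using \<theta>M(1)[of "i1 + N * q"] le[of N "i1 + N * q"] by linarith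
    then show ?thesis using \<open>\<psi> + pi < \<theta> N\<close> i1 bad_per[of i1 N] by (intro exI[of _ "i1 + N * q"]) simp
  qed
  then have "bad k \<and> \<psi> + pi \<le> M k" unfolding k_def by (rule LeastI_ex)
  then have k: "bad k" "\<psi> + pi \<le> M k" by auto
  have k_min: "k \<le> i" if "bad i" "\<psi> + pi \<le> M i" for i
    unfolding k_def by (rule Least_le) (use that in simp)
  have qk: "q \<le> k" using small[of k] k(2) pi_gt_zero by (intro leI notI) linarith
  \<comment> \<open>Otherwise everything lies in an open half plane, whose inner normal is the direction \<open>\<omega>\<close> below.\<close>
  have gap: "M k \<le> M j + pi"
  proof (rule ccontr)
    assume "\<not> M k \<le> M j + pi"
    then have wide: "M j + pi < M k" by simp
    then have strict: "M j < \<psi> + pi" "\<psi> + pi < M k"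
      using k_min[OF j(1)] j_max[OF k(1)] j(2) k(2) pi_gt_zero M_le[of k j] by linarith+
    define \<alpha> where "\<alpha> = min (M k) (\<psi> + 2 * pi)"
    define \<beta> where "\<beta> = max (M j + 2 * pi) (\<psi> + 2 * pi)"
    define \<omega> where "\<omega> = (\<alpha> + \<beta>) / 2"
    have "\<beta> - \<alpha> < pi" using strict wide pi_gt_zero unfolding \<alpha>_def \<beta>_def by linarith
    then have cos_pos: "0 < cos (x - \<omega>)" if "\<alpha> \<le> x" "x \<le> \<beta>" for x
      by (intro cos_gt_zero_pi) (use that in \<open>auto simp: \<omega>_def field_simps\<close>)
    have "cos (\<psi> - \<omega>) = cos (\<psi> + 2 * pi - \<omega>)" using cos_periodic[of "\<psi> - \<omega>"] by (simp add: algebra_simps)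
    also have "0 < \<dots>" by (rule cos_pos) (auto simp: \<alpha>_def \<beta>_def)
    finally have lhs: "0 \<le> (\<kappa> *\<^sub>R dir \<psi>) \<bullet> dir \<omega>" using \<open>0 \<le> \<kappa>\<close> by (simp add: inner_dir)
    have bad_pos: "0 < cos (M i - \<omega>)" if "bad i" "i < q" for i
    proof -
      \<comment> \<open>Turn the wedge by full circles to the first representative from k on; the one before it is at most j.\<close>
      define n where "n = (LEAST n. k \<le> i + n * q)"
      have "k \<le> i + k * q" using pq by (simp add: trans_le_add2)
      then have n: "k \<le> i + n * q" unfolding n_def by (rule LeastI)
      then have "n \<noteq> 0" using that qk by (intro notI) simp
      then obtain n' where n': "n = Suc n'" using not0_implies_Suc by blast
      have "\<not> k \<le> i + n' * q" using not_less_Least[of n' "\<lambda>n. k \<le> i + n * q"] n' by (simp add: n_def)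
      then have "i + n' * q \<le> j"
        using k_min[of "i + n' * q"] j_max[of "i + n' * q"] bad_per[of i n'] that by fastforce
      then have "M i + 2 * pi * real n' \<le> M j" using M_le[of "i + n' * q" j] M_per[of i n'] by simp
      moreover have "M k \<le> M i + 2 * pi * real n" using n M_le[of k "i + n * q"] M_per[of i n] by simp
      ultimately have "0 < cos (M i + 2 * pi * real n - \<omega>)"
        by (intro cos_pos) (auto simp: \<alpha>_def \<beta>_def n' algebra_simps)
      also have "\<dots> = cos (M i - \<omega>)"
        using inner_dir[of "M i + 2 * pi * real n" \<omega>] inner_dir[of "M i" \<omega>] by simp
      finally show ?thesis .
    qed
    have width: "0 \<le> \<theta> (i + p) - \<theta> i" "\<theta> (i + p) - \<theta> i < 2 * pi" for i
      using le[of i "i + p"] less[of "i + p" "i + q"] fan_period[OF fan, of i] pq by auto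
    have weight: "cos ((\<theta> (i + p) - \<theta> i) / 2) < 0 \<longleftrightarrow> bad i" for i
    proof
      assume neg: "cos ((\<theta> (i + p) - \<theta> i) / 2) < 0"
      show "bad i"
      proof (rule ccontr)
        assume "\<not> bad i"
        then have "0 \<le> cos ((\<theta> (i + p) - \<theta> i) / 2)"
          by (intro cos_ge_zero) (use width[of i] in \<open>auto simp: bad_def field_simps\<close>)
        then show False using neg by simp
      qed
    next
      assume "bad i"
      then have "pi/2 < (\<theta> (i + p) - \<theta> i) / 2" "(\<theta> (i + p) - \<theta> i) / 2 < pi"
        using width[of i] by (simp_all add: bad_def field_simps)
      then show "cos ((\<theta> (i + p) - \<theta> i) / 2) < 0"
        using cos_gt_zero_pi[of "(\<theta> (i + p) - \<theta> i) / 2 - pi"] pi_half_gt_zero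
          cos_minus_pi[of "(\<theta> (i + p) - \<theta> i) / 2"] by linarith
    qed
    have "pull p q \<theta> \<bullet> dir \<omega> = (\<Sum>i<q. min 0 (cos ((\<theta> (i + p) - \<theta> i) / 2)) * cos (M i - \<omega>))"
      by (simp add: pull_def inner_sum_left inner_dir M_def)
    also have "\<dots> < (\<Sum>i<q. 0)"
    proof (rule sum_strict_mono_ex1)
      show "\<forall>i\<in>{..<q}. min 0 (cos ((\<theta> (i + p) - \<theta> i) / 2)) * cos (M i - \<omega>) \<le> 0"
        using bad_pos weight by (auto simp: min_def mult_le_0_iff not_le intro: less_imp_le)
      show "\<exists>i\<in>{..<q}. min 0 (cos ((\<theta> (i + p) - \<theta> i) / 2)) * cos (M i - \<omega>) < 0"
        using bad_pos[OF i1] weight[of i1] i1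
        by (intro bexI[of _ i1]) (auto simp: min_def mult_less_0_iff not_le)
    qed simp
    finally show False using lhs eq by simp
  qed
  have "\<theta> j < \<theta> (l + p)" using badM(1)[OF j(1)] j(2) l(3) by linarith
  then have "j < l + p" by (simp add: less)
  moreover have "\<theta> k < \<theta> (j + p)" using badM(1)[OF k(1)] badM(2)[OF j(1)] gap by linarith
  then have "k < j + p" by (simp add: less)
  moreover have "\<theta> (l + q) < \<theta> (k + p)"
    using badM(2)[OF k(1)] k(2) l(2) fan_period[OF fan, of l] by linarith
  then have "l + q < k + p" by (simp add: less)
  ultimately show False using pq by linarith
qed

text \<open>Apply Brouwer's theorem to \<open>x + v x\<close> followed by the radial retraction onto the ball.\<close>

lemma brouwer_zero_or_outward:
  fixes v :: "'a::euclidean_space \<Rightarrow> 'a"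
  assumes "continuous_on UNIV v" "0 < R"
  obtains c \<kappa> where "v c = \<kappa> *\<^sub>R c" "0 \<le> \<kappa>" "\<kappa> = 0 \<or> norm c = R"
proof -
  define f where "f x = (R / max R (norm (x + v x))) *\<^sub>R (x + v x)" for x
  have mx: "0 < max R (norm (x + v x))" for x using assms(2) by simp
  have "continuous_on (cball 0 R) f" unfolding f_def
    by (intro continuous_intros continuous_on_subset[OF assms(1)]) (use mx in \<open>auto simp: less_le\<close>)
  moreover have "f ` cball 0 R \<subseteq> cball 0 R"
  proof clarify
    fix x
    have "R * norm (x + v x) \<le> R * max R (norm (x + v x))" using assms(2) by (intro mult_left_mono) auto
    then show "f x \<in> cball 0 R" using mx[of x] assms(2)
      by (simp add: f_def divide_le_eq abs_of_pos)
  qed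
  ultimately obtain x where x: "x \<in> cball 0 R" "f x = x"
    using brouwer[of "cball 0 R" f] assms(2) by (auto simp: image_subset_iff_funcset [symmetric])
  define m where "m = max R (norm (x + v x))"
  have m: "0 < m" "R \<le> m" using mx[of x] by (auto simp: m_def)
  have "x = (R / m) *\<^sub>R (x + v x)" using x(2) by (simp add: f_def m_def)
  then have "(m / R) *\<^sub>R x = (m / R) *\<^sub>R ((R / m) *\<^sub>R (x + v x))" by simp
  then have "(m / R) *\<^sub>R x = x + v x" using m assms(2) by simp
  then have "v x = (m / R - 1) *\<^sub>R x" by (simp add: algebra_simps)
  moreover have "0 \<le> m / R - 1" using m assms(2) by (simp add: field_simps)
  moreover have "m / R - 1 = 0 \<or> norm x = R"
  proof (cases "m = R")
    case False
    then have "m = norm (x + v x)" by (auto simp: m_def)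
    have "norm x = norm ((R / m) *\<^sub>R (x + v x))" using x(2) by (simp add: f_def m_def)
    also have "\<dots> = R / m * norm (x + v x)" using m assms(2) by simp
    also have "\<dots> = R" using m \<open>m = norm (x + v x)\<close> by simp
    finally show ?thesis by simp
  qed (use assms(2) in simp)
  ultimately show ?thesis using that by blast
qed

lemma mass_tail:
  assumes "mass \<mu>" "0 < \<epsilon>"
  obtains R where "0 < R" "measure \<mu> {x. R \<le> norm x} < \<epsilon>"
proof -
  interpret finite_measure \<mu> using mass_facts assms by blast
  define A where "A n = {x :: real^2. real n \<le> norm x}" for n
  have "closed (A n)" for n unfolding A_def by (intro closed_Collect_le continuous_intros)
  then have sets: "range A \<subseteq> sets \<mu>" by (auto simp: mass_facts(3)[OF assms(1)] borel_closed)
  have "decseq A" by (force simp: decseq_def A_def)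
  moreover have "(\<Inter>n. A n) = {}"
  proof -
    have "\<exists>n. x \<notin> A n" for x
      using reals_Archimedean2[of "norm x"] by (auto simp: A_def not_le)
    then show ?thesis by blast
  qed
  ultimately have "(\<lambda>n. measure \<mu> (A n)) \<longlonglongrightarrow> 0"
    using finite_Lim_measure_decseq[OF sets] by simp
  then have "\<forall>\<^sub>F n in sequentially. measure \<mu> (A n) < \<epsilon>" using order_tendstoD(2) assms(2) by blast
  then obtain N where "\<And>n. N \<le> n \<Longrightarrow> measure \<mu> (A n) < \<epsilon>" by (auto simp: eventually_sequentially)
  from this[of "Suc N"] show ?thesis using that[of "real (Suc N)"] unfolding A_def by simp
qed

lemma halfplane_avoids_ball:
  assumes "norm c = R"
  obtains \<psi> where "c = R *\<^sub>R dir \<psi>" "sweep c (\<psi> - pi/2) (\<psi> + pi/2) \<subseteq> {x. R \<le> norm x}"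
proof -
  obtain \<rho> \<psi> where \<psi>: "0 \<le> \<rho>" "c = \<rho> *\<^sub>R dir \<psi>" using polar_form by metis
  then have c: "c = R *\<^sub>R dir \<psi>" using assms by simp
  have "sweep c (\<psi> - pi/2) (\<psi> + pi/2) \<subseteq> {x. R \<le> norm x}"
  proof
    fix x assume "x \<in> sweep c (\<psi> - pi/2) (\<psi> + pi/2)"
    moreover have "sweep c (\<psi> - pi/2) (\<psi> + pi/2) = {x. 0 \<le> (x - c) \<bullet> dir \<psi>}"
      using sweep_halfplane[of c "\<psi> - pi/2"] by (simp add: add.commute)
    ultimately have "0 \<le> (x - c) \<bullet> dir \<psi>" by auto
    then have "R \<le> x \<bullet> dir \<psi>" by (simp add: c inner_diff_left inner_dir)
    also have "\<dots> \<le> norm x" using norm_cauchy_schwarz[of x "dir \<psi>"] by simp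
    finally show "x \<in> {x. R \<le> norm x}" by simp
  qed
  then show ?thesis using c that by blast
qed

text \<open>On a circle of radius \<open>R\<close> beyond which there is mass less than \<open>1 / q\<close>, the half plane facing
  outward contains no complete wedge. It therefore fits into two neighbouring wedges, and so into a \<open>p\<close>-wedge,
  as \<open>p \<ge> 2\<close>.\<close>

lemma equi_fan_narrow_full_support:
  assumes \<mu>: "mass \<mu>" "full_support \<mu>" and pq: "2 \<le> p" "p < q" "3 * p < q + 3"
  obtains c \<theta> where "equi_fan q \<mu> c \<theta>" "narrow p \<theta>"
proof (rule ccontr)
  assume none: "\<not> thesis"
  interpret finite_measure \<mu> using mass_facts \<mu> by blast
  have q: "0 < q" using pq by simp
  let ?\<theta> = "measure_fan \<mu> q 0"
  have fan: "equi_fan q \<mu> c (?\<theta> c)" for c by (rule equi_fan_measure_fan[OF \<mu> q])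
  then have fan': "fan_angles q (?\<theta> c)" for c by (simp add: equi_fan_def)
  have bad: "\<exists>i. ?\<theta> c i + pi < ?\<theta> c (i + p)" for c
    using none that fan[of c] by (force simp: narrow_def not_le)
  obtain R where R: "0 < R" "measure \<mu> {x. R \<le> norm x} < 1 / real q"
    using mass_tail[OF \<mu>(1), of "1 / real q"] q by auto
  have "continuous_on UNIV (\<lambda>c. pull p q (?\<theta> c))"
    unfolding pull_def by (intro continuous_intros continuous_measure_fan \<mu> q) auto
  then obtain c \<kappa> where c: "pull p q (?\<theta> c) = \<kappa> *\<^sub>R c" "0 \<le> \<kappa>" "\<kappa> = 0 \<or> norm c = R"
    using brouwer_zero_or_outward R(1) by blast
  let ?t = "?\<theta> c"
  obtain i0 where i0: "?t i0 + pi < ?t (i0 + p)" using bad by blast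
  note no = pull_ne_outward[OF fan'[of c] _ pq(2,3) i0]
  from c(3) show False
  proof
    assume "\<kappa> = 0"
    \<comment> \<open>Two full turns give room for the wedges of smaller index that \<open>pull_ne_outward\<close> looks at.\<close>
    define l where "l = i0 + 2 * q"
    have "?t l = ?t i0 + 2 * pi * 2" "?t (l + p) = ?t (i0 + p) + 2 * pi * 2"
      using fan_shift[OF fan'[of c], of i0 2] fan_shift[OF fan'[of c], of "i0 + p" 2]
      by (simp_all add: l_def ac_simps)
    then show False using no[of l "(?t l + ?t (l + p)) / 2" 0] c(1) \<open>\<kappa> = 0\<close> i0 pq
      by (simp add: l_def field_simps)
  next
    assume "norm c = R"
    then obtain \<psi> where \<psi>: "c = R *\<^sub>R dir \<psi>" "sweep c (\<psi> - pi/2) (\<psi> + pi/2) \<subseteq> {x. R \<le> norm x}"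
      using halfplane_avoids_ball by blast
    obtain k m where km: "?t m \<le> \<psi> - pi/2 + 2 * pi * real k" "\<psi> - pi/2 + 2 * pi * real k < ?t (Suc m)"
      using fan_locate[OF fan'] .
    have "\<psi> + pi/2 + 2 * pi * real k \<le> ?t (Suc (Suc m))"
    proof (rule ccontr)
      assume *: "\<not> \<psi> + pi/2 + 2 * pi * real k \<le> ?t (Suc (Suc m))"
      have "sweep c (?t (Suc m)) (?t (Suc (Suc m))) \<subseteq> sweep c (\<psi> - pi/2 + 2 * pi * of_int (int k)) (\<psi> + pi/2 + 2 * pi * of_int (int k))"
        by (rule sweep_mono) (use km * in auto)
      also have "\<dots> = sweep c (\<psi> - pi/2) (\<psi> + pi/2)" by (rule sweep_shift)
      also have "\<dots> \<subseteq> {x. R \<le> norm x}" by (rule \<psi>)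
      finally have "measure \<mu> (sweep c (?t (Suc m)) (?t (Suc (Suc m)))) \<le> measure \<mu> {x. R \<le> norm x}"
      proof (rule finite_measure_mono)
        have "closed {x :: real^2. R \<le> norm x}" by (intro closed_Collect_le continuous_intros)
        then show "{x. R \<le> norm x} \<in> sets \<mu>" by (simp add: mass_facts(3)[OF \<mu>(1)] borel_closed)
      qed
      then show False using fan[of c] R by (simp add: equi_fan_def)
    qed
    also have "?t (Suc (Suc m)) \<le> ?t (m + p)" unfolding fan_le_iff[OF fan'[of c]] using pq by simp
    finally have up: "\<psi> + pi/2 + 2 * pi * real k \<le> ?t (m + p)" .
    define \<psi>' where "\<psi>' = \<psi> + 2 * pi * real (k + 2)"
    have "?t (m + 2 * q) = ?t m + 2 * pi * 2" "?t (m + 2 * q + p) = ?t (m + p) + 2 * pi * 2"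
      using fan_shift[OF fan'[of c], of m 2] fan_shift[OF fan'[of c], of "m + p" 2] by (simp_all add: ac_simps)
    then have "pull p q ?t \<noteq> (\<kappa> * R) *\<^sub>R dir \<psi>'"
      by (intro no[of "m + 2 * q" \<psi>' "\<kappa> * R"]) (use km up pq R c in \<open>auto simp: \<psi>'_def algebra_simps\<close>)
    then show False using c(1) \<psi>(1) unfolding \<psi>'_def dir_shift_nat by simp
  qed
qed

section \<open>Existence at the threshold: three concurrent halving lines\<close>

lemma eventually_halfplane:
  fixes x :: "real^2"
  assumes "u \<longlonglongrightarrow> u0" "k \<longlonglongrightarrow> k0" "x \<bullet> u0 \<noteq> k0"
  shows "\<forall>\<^sub>F n in sequentially. x \<bullet> u n \<le> k n \<longleftrightarrow> x \<bullet> u0 \<le> k0"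
proof -
  have lim: "(\<lambda>n. k n - x \<bullet> u n) \<longlonglongrightarrow> k0 - x \<bullet> u0" by (intro tendsto_intros assms)
  show ?thesis
  proof (cases "x \<bullet> u0 \<le> k0")
    case True
    have "\<forall>\<^sub>F n in sequentially. 0 < k n - x \<bullet> u n"
      by (rule order_tendstoD(1)[OF lim]) (use True assms(3) in simp)
    then show ?thesis by eventually_elim (use True in simp)
  next
    case False
    have "\<forall>\<^sub>F n in sequentially. k n - x \<bullet> u n < 0"
      by (rule order_tendstoD(2)[OF lim]) (use False in simp)
    then show ?thesis by eventually_elim (use False in simp)
  qed
qed

text \<open>The two sides of the line at signed distance \<open>h\<close> from the origin that runs in direction \<open>\<phi>\<close>.\<close>

definition right_half :: "real \<Rightarrow> real \<Rightarrow> (real^2) set" where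
  "right_half \<phi> h = {x. x \<bullet> dir (\<phi> + pi/2) \<le> h}"

definition left_half :: "real \<Rightarrow> real \<Rightarrow> (real^2) set" where
  "left_half \<phi> h = {x. h \<le> x \<bullet> dir (\<phi> + pi/2)}"

lemma half_sets:
  assumes "mass \<mu>" shows "right_half \<phi> h \<in> sets \<mu>" "left_half \<phi> h \<in> sets \<mu>"
proof -
  have "closed (right_half \<phi> h)" "closed (left_half \<phi> h)"
    unfolding right_half_def left_half_def by (intro closed_Collect_le continuous_intros)+
  then show "right_half \<phi> h \<in> sets \<mu>" "left_half \<phi> h \<in> sets \<mu>"
    by (simp_all add: mass_facts(3)[OF assms] borel_closed)
qed

lemma line_null:
  assumes "mass \<mu>" shows "{x. x \<bullet> dir t = k} \<in> null_sets \<mu>"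
  using hyperplane_null[OF assms dir_nonzero, of t k] by (simp add: inner_commute)

lemma half_plus_pi: "right_half (\<phi> + pi) h = left_half \<phi> (- h)" "left_half (\<phi> + pi) h = right_half \<phi> (- h)"
proof -
  have "dir (\<phi> + pi + pi/2) = - dir (\<phi> + pi/2)"
    using dir_add_pi[of "\<phi> + pi/2"] by (simp add: algebra_simps)
  then show "right_half (\<phi> + pi) h = left_half \<phi> (- h)" "left_half (\<phi> + pi) h = right_half \<phi> (- h)"
    by (auto simp: right_half_def left_half_def)
qed

lemma measure_split_line:
  assumes "mass \<mu>" "S \<in> sets \<mu>"
  shows "measure \<mu> S = measure \<mu> (S \<inter> right_half \<phi> h) + measure \<mu> (S \<inter> left_half \<phi> h)"
proof -
  interpret finite_measure \<mu> using mass_facts assms by blast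
  have "AE x in \<mu>. x \<notin> S \<inter> right_half \<phi> h \<or> x \<notin> S \<inter> left_half \<phi> h"
    by (rule AE_I'[OF line_null[OF assms(1), of "\<phi> + pi/2" h]]) (auto simp: right_half_def left_half_def)
  then have "measure \<mu> (S \<inter> right_half \<phi> h \<union> S \<inter> left_half \<phi> h)
      = measure \<mu> (S \<inter> right_half \<phi> h) + measure \<mu> (S \<inter> left_half \<phi> h)"
    using assms half_sets[OF assms(1)] by (intro measure_Un_AE) (auto simp: fmeasurable_eq_sets)
  moreover have "S \<inter> right_half \<phi> h \<union> S \<inter> left_half \<phi> h = S"
    by (auto simp: right_half_def left_half_def)
  ultimately show ?thesis by simp
qed

lemma full_support_pos:
  assumes "mass \<mu>" "full_support \<mu>" "open U" "x \<in> U" "U \<subseteq> S" "S \<in> sets \<mu>"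
  shows "0 < measure \<mu> S"
proof -
  interpret finite_measure \<mu> using mass_facts assms by blast
  have "0 < measure \<mu> U" using assms by (auto simp: full_support_def)
  also have "\<dots> \<le> measure \<mu> S" using assms by (intro finite_measure_mono)
  finally show ?thesis .
qed

lemma point_with_coordinates:
  assumes "sin d \<noteq> 0"
  obtains x where "x \<bullet> dir (t + pi/2) = A" "x \<bullet> dir (t + d + pi/2) = B"
proof
  let ?x = "(A / sin d) *\<^sub>R dir (t + d) - (B / sin d) *\<^sub>R dir t"
  have "cos (t + d - (t + pi/2)) = sin d" "cos (t - (t + pi/2)) = 0"
    "cos (t + d - (t + d + pi/2)) = 0" "cos (t - (t + d + pi/2)) = - sin d"
    using cos_add[of d "pi/2"] cos_diff[of d "pi/2"] cos_minus[of "d + pi/2"] by (simp_all add: algebra_simps)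
  then show "?x \<bullet> dir (t + pi/2) = A" "?x \<bullet> dir (t + d + pi/2) = B"
    using assms by (simp_all add: inner_diff_left inner_dir)
qed

lemma right_half_strict_mono:
  assumes "mass \<mu>" "full_support \<mu>" "h < h'"
  shows "measure \<mu> (right_half \<phi> h) < measure \<mu> (right_half \<phi> h')"
proof -
  obtain x where x: "x \<bullet> dir (\<phi> + pi/2) = (h + h') / 2"
    by (rule point_with_coordinates[of "pi/2" \<phi> "(h + h') / 2" 0]) auto
  have "0 < measure \<mu> (right_half \<phi> h' \<inter> left_half \<phi> h)"
  proof (rule full_support_pos[OF assms(1,2)])
    show "open {x. h < x \<bullet> dir (\<phi> + pi/2) \<and> x \<bullet> dir (\<phi> + pi/2) < h'}"
      by (intro open_Collect_conj open_Collect_less continuous_intros)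
    show "x \<in> {x. h < x \<bullet> dir (\<phi> + pi/2) \<and> x \<bullet> dir (\<phi> + pi/2) < h'}" using x assms(3) by simp
  qed (use half_sets[OF assms(1)] in \<open>auto simp: right_half_def left_half_def\<close>)
  moreover have "right_half \<phi> h' \<inter> right_half \<phi> h = right_half \<phi> h"
    using assms(3) by (auto simp: right_half_def)
  ultimately show ?thesis
    using measure_split_line[OF assms(1) half_sets(1)[OF assms(1)], of \<phi> h' \<phi> h] by simp
qed

lemma tendsto_right_half:
  assumes "mass \<mu>" "\<phi> \<longlonglongrightarrow> \<phi>0" "h \<longlonglongrightarrow> h0"
  shows "(\<lambda>n. measure \<mu> (right_half (\<phi> n) (h n))) \<longlonglongrightarrow> measure \<mu> (right_half \<phi>0 h0)"
proof (rule tendsto_measure_of_membership[OF mass_facts(2)[OF assms(1)] half_sets(1)[OF assms(1)] half_sets(1)[OF assms(1)]])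
  show "{x. x \<bullet> dir (\<phi>0 + pi/2) = h0} \<in> null_sets \<mu>" by (rule line_null[OF assms(1)])
  show "\<forall>\<^sub>F n in sequentially. x \<in> right_half (\<phi> n) (h n) \<longleftrightarrow> x \<in> right_half \<phi>0 h0"
    if "x \<notin> {x. x \<bullet> dir (\<phi>0 + pi/2) = h0}" for x
    unfolding right_half_def mem_Collect_eq
    by (rule eventually_halfplane) (use that assms in \<open>auto intro!: tendsto_intros\<close>)
qed

definition halving_offset :: "(real^2) measure \<Rightarrow> real \<Rightarrow> real" where
  "halving_offset \<mu> \<phi> = (THE h. measure \<mu> (right_half \<phi> h) = 1/2)"

lemma right_half_eqD:
  assumes "mass \<mu>" "full_support \<mu>" "measure \<mu> (right_half \<phi> h) = measure \<mu> (right_half \<phi> h')"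
  shows "h = h'"
  using right_half_strict_mono[OF assms(1,2), of h h' \<phi>] right_half_strict_mono[OF assms(1,2), of h' h \<phi>] assms(3)
  by (cases h h' rule: linorder_cases) auto

lemma halving_offset_bounds:
  assumes "mass \<mu>"
  obtains R where "0 < R" "\<And>\<phi>. measure \<mu> (right_half \<phi> (- R)) < 1/2" "\<And>\<phi>. 1/2 < measure \<mu> (right_half \<phi> R)"
proof -
  interpret prob_space \<mu> using mass_facts assms by blast
  obtain R where R: "0 < R" "measure \<mu> {x. R \<le> norm x} < 1/2" using mass_tail[OF assms, of "1/2"] by auto
  have "closed {x :: real^2. R \<le> norm x}" by (intro closed_Collect_le continuous_intros)
  then have tail: "{x. R \<le> norm x} \<in> sets \<mu>" by (simp add: mass_facts(3)[OF assms] borel_closed)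
  have "\<bar>x \<bullet> dir t\<bar> \<le> norm x" for x t using Cauchy_Schwarz_ineq2[of x "dir t"] by simp
  then have "x \<bullet> dir t \<le> norm x" "- norm x \<le> x \<bullet> dir t" for x t by (simp_all add: abs_le_iff minus_le_iff)
  note * = this
  have sub: "right_half \<phi> (- R) \<subseteq> {x. R \<le> norm x}" "left_half \<phi> R \<subseteq> {x. R \<le> norm x}" for \<phi>
    unfolding right_half_def left_half_def
    using order_trans[OF *(2)] order_trans[OF _ *(1)] by force+
  have small: "measure \<mu> (right_half \<phi> (- R)) < 1/2" "measure \<mu> (left_half \<phi> R) < 1/2" for \<phi>
    using finite_measure_mono[OF sub(1) tail, of \<phi>] finite_measure_mono[OF sub(2) tail, of \<phi>] R by linarith+
  have total: "measure \<mu> (right_half \<phi> R) + measure \<mu> (left_half \<phi> R) = 1" for \<phi>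
    using measure_split_line[OF assms, of UNIV \<phi> R] prob_space by (simp add: mass_facts(3,4)[OF assms])
  have "1/2 < measure \<mu> (right_half \<phi> R)" for \<phi> using small(2)[of \<phi>] total[of \<phi>] by linarith
  then show ?thesis using that[of R] R(1) small(1) by blast
qed

lemma halving_offset:
  assumes "mass \<mu>" "full_support \<mu>"
  shows "measure \<mu> (right_half \<phi> (halving_offset \<mu> \<phi>)) = 1/2"
    "measure \<mu> (left_half \<phi> (halving_offset \<mu> \<phi>)) = 1/2"
proof -
  interpret prob_space \<mu> using mass_facts assms by blast
  obtain R where R: "0 < R" "measure \<mu> (right_half \<phi> (- R)) < 1/2" "1/2 < measure \<mu> (right_half \<phi> R)"
    using halving_offset_bounds[OF assms(1)] by metis
  have "continuous_on {- R..R} (\<lambda>h. measure \<mu> (right_half \<phi> h))"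
    unfolding continuous_on_sequentially comp_def
    by (auto intro!: tendsto_right_half[OF assms(1)])
  then have "\<exists>h. - R \<le> h \<and> h \<le> R \<and> measure \<mu> (right_half \<phi> h) = 1/2"
    using R by (intro IVT') auto
  then have "\<exists>!h. measure \<mu> (right_half \<phi> h) = 1/2" using right_half_eqD[OF assms, of \<phi>] by metis
  then show 1: "measure \<mu> (right_half \<phi> (halving_offset \<mu> \<phi>)) = 1/2"
    unfolding halving_offset_def by (rule theI')
  show "measure \<mu> (left_half \<phi> (halving_offset \<mu> \<phi>)) = 1/2"
    using measure_split_line[OF assms(1), of UNIV \<phi> "halving_offset \<mu> \<phi>"] prob_space 1
    by (simp add: mass_facts(3,4)[OF assms(1)])
qed

lemma halving_offset_plus_pi:
  assumes "mass \<mu>" "full_support \<mu>"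
  shows "halving_offset \<mu> (\<phi> + pi) = - halving_offset \<mu> \<phi>"
proof (rule right_half_eqD[OF assms])
  show "measure \<mu> (right_half (\<phi> + pi) (halving_offset \<mu> (\<phi> + pi))) = measure \<mu> (right_half (\<phi> + pi) (- halving_offset \<mu> \<phi>))"
    unfolding half_plus_pi(1)[of \<phi> "- halving_offset \<mu> \<phi>"] by (simp add: halving_offset[OF assms])
qed

lemma continuous_halving_offset:
  assumes "mass \<mu>" "full_support \<mu>"
  shows "continuous_on UNIV (halving_offset \<mu>)"
proof -
  obtain R where R: "0 < R" "\<And>\<phi>. measure \<mu> (right_half \<phi> (- R)) < 1/2" "\<And>\<phi>. 1/2 < measure \<mu> (right_half \<phi> R)"
    using halving_offset_bounds[OF assms(1)] by metis
  have le: "measure \<mu> (right_half \<phi> h) \<le> measure \<mu> (right_half \<phi> h')" if "h \<le> h'" for \<phi> h h'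
    using right_half_strict_mono[OF assms, of h h' \<phi>] that by (cases "h = h'") auto
  show ?thesis
  proof (rule continuous_on_root[where l = "- R" and u = R and s = "1/2" and g = "\<lambda>\<phi> h. measure \<mu> (right_half \<phi> h)"])
    show "- R < halving_offset \<mu> \<phi> \<and> halving_offset \<mu> \<phi> < R" for \<phi>
      using le[of "halving_offset \<mu> \<phi>" "- R" \<phi>] le[of R "halving_offset \<mu> \<phi>" \<phi>] R(2)[of \<phi>] R(3)[of \<phi>]
        halving_offset[OF assms, of \<phi>] by linarith
    show "continuous_on UNIV (\<lambda>\<phi>. measure \<mu> (right_half \<phi> h))" for h
      unfolding continuous_on_sequentially comp_def by (auto intro!: tendsto_right_half[OF assms(1)])
  qed (use halving_offset[OF assms] right_half_strict_mono[OF assms] in auto)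
qed

text \<open>The part to the left of the halving line of direction \<open>\<phi>\<close> and to the right of the one of direction
  \<open>\<phi> + \<psi>\<close>. It is a wedge at their intersection; this description remains meaningful when the two lines coincide.\<close>

definition halving_sector :: "(real^2) measure \<Rightarrow> real \<Rightarrow> real \<Rightarrow> (real^2) set" where
  "halving_sector \<mu> \<phi> \<psi> =
    left_half \<phi> (halving_offset \<mu> \<phi>) \<inter> right_half (\<phi> + \<psi>) (halving_offset \<mu> (\<phi> + \<psi>))"

lemma tendsto_halving_sector:
  assumes \<mu>: "mass \<mu>" "full_support \<mu>" and lim: "\<phi> \<longlonglongrightarrow> \<phi>0" "\<psi> \<longlonglongrightarrow> \<psi>0"
  shows "(\<lambda>n. measure \<mu> (halving_sector \<mu> (\<phi> n) (\<psi> n))) \<longlonglongrightarrow> measure \<mu> (halving_sector \<mu> \<phi>0 \<psi>0)"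
proof (rule tendsto_measure_of_membership[OF mass_facts(2)[OF \<mu>(1)]])
  let ?h = "halving_offset \<mu>"
  show "halving_sector \<mu> (\<phi> n) (\<psi> n) \<in> sets \<mu>" "halving_sector \<mu> \<phi>0 \<psi>0 \<in> sets \<mu>" for n
    unfolding halving_sector_def using half_sets[OF \<mu>(1)] by auto
  let ?N = "{x. x \<bullet> dir (\<phi>0 + pi/2) = ?h \<phi>0} \<union> {x. x \<bullet> dir (\<phi>0 + \<psi>0 + pi/2) = ?h (\<phi>0 + \<psi>0)}"
  show "?N \<in> null_sets \<mu>" by (intro null_sets.Un line_null[OF \<mu>(1)])
  have h: "(\<lambda>n. ?h (t n)) \<longlonglongrightarrow> ?h t0" if "t \<longlonglongrightarrow> t0" for t t0
    using continuous_on_tendsto_compose[OF continuous_halving_offset[OF \<mu>] that] by simp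
  fix x assume x: "x \<notin> ?N"
  have "\<forall>\<^sub>F n in sequentially. x \<bullet> (- dir (\<phi> n + pi/2)) \<le> - ?h (\<phi> n) \<longleftrightarrow> x \<bullet> (- dir (\<phi>0 + pi/2)) \<le> - ?h \<phi>0"
    by (rule eventually_halfplane) (use x lim in \<open>auto intro!: tendsto_intros h\<close>)
  moreover have "\<forall>\<^sub>F n in sequentially. x \<bullet> dir (\<phi> n + \<psi> n + pi/2) \<le> ?h (\<phi> n + \<psi> n) \<longleftrightarrow> x \<bullet> dir (\<phi>0 + \<psi>0 + pi/2) \<le> ?h (\<phi>0 + \<psi>0)"
    by (rule eventually_halfplane) (use x lim in \<open>auto intro!: tendsto_intros h\<close>)
  ultimately show "\<forall>\<^sub>F n in sequentially. x \<in> halving_sector \<mu> (\<phi> n) (\<psi> n) \<longleftrightarrow> x \<in> halving_sector \<mu> \<phi>0 \<psi>0"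
    by eventually_elim (simp add: halving_sector_def left_half_def right_half_def)
qed

lemma halving_sector_0_pi:
  assumes "mass \<mu>" "full_support \<mu>"
  shows "measure \<mu> (halving_sector \<mu> \<phi> 0) = 0" "measure \<mu> (halving_sector \<mu> \<phi> pi) = 1/2"
proof -
  have "halving_sector \<mu> \<phi> 0 = {x. x \<bullet> dir (\<phi> + pi/2) = halving_offset \<mu> \<phi>}"
    by (auto simp: halving_sector_def left_half_def right_half_def)
  then show "measure \<mu> (halving_sector \<mu> \<phi> 0) = 0"
    using line_null[OF assms(1)] by (simp add: measure_eq_0_null_sets)
  have "halving_sector \<mu> \<phi> pi = left_half \<phi> (halving_offset \<mu> \<phi>)"
    by (simp add: halving_sector_def half_plus_pi halving_offset_plus_pi[OF assms])
  then show "measure \<mu> (halving_sector \<mu> \<phi> pi) = 1/2" by (simp add: halving_offset[OF assms])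
qed

text \<open>Two halving lines cut off opposite sectors of equal measure.\<close>

lemma halving_sector_plus_pi:
  assumes "mass \<mu>" "full_support \<mu>"
  shows "measure \<mu> (halving_sector \<mu> (\<phi> + pi) \<psi>) = measure \<mu> (halving_sector \<mu> \<phi> \<psi>)"
proof -
  let ?h = "halving_offset \<mu>"
  let ?L = "left_half \<phi> (?h \<phi>)" and ?R = "right_half \<phi> (?h \<phi>)"
  let ?L' = "left_half (\<phi> + \<psi>) (?h (\<phi> + \<psi>))" and ?R' = "right_half (\<phi> + \<psi>) (?h (\<phi> + \<psi>))"
  note sets = half_sets[OF assms(1)]
  have eq: "\<phi> + pi + \<psi> = \<phi> + \<psi> + pi" by simp
  have "halving_sector \<mu> (\<phi> + pi) \<psi> = ?R \<inter> ?L'"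
    unfolding halving_sector_def eq by (simp add: half_plus_pi halving_offset_plus_pi[OF assms])
  moreover have "measure \<mu> ?L = measure \<mu> (?L \<inter> ?R') + measure \<mu> (?L \<inter> ?L')"
    "measure \<mu> ?L' = measure \<mu> (?L' \<inter> ?R) + measure \<mu> (?L' \<inter> ?L)"
    by (rule measure_split_line[OF assms(1) sets(2)])+
  ultimately show ?thesis
    by (simp add: halving_sector_def halving_offset[OF assms] Int_commute)
qed

lemma dir_between: "sin b *\<^sub>R dir (t + a) = sin (b - a) *\<^sub>R dir t + sin a *\<^sub>R dir (t + b)"
  by (simp add: vec_eq_iff forall_2 cos_add sin_add sin_diff algebra_simps)

text \<open>The halving lines of directions \<open>\<phi> + \<psi>\<close> and \<open>\<phi> + \<psi>'\<close> cut off two opposite sectors of equal measure; rotating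
  the second side of the sector gains one of them and loses the other, as far as they lie to the left of the first line. Where
  the two lines cross decides which one is not cut by the first line: if they cross to the left, the gained sector lies
  there completely and the lost one sticks out; if they cross to the right, nothing is lost and something is gained. The normals \<open>n0\<close>, \<open>n1\<close>,
  \<open>n2\<close> satisfy a relation with positive coefficients, which expresses this without mentioning the crossing point.\<close>

lemma halving_sector_strict_mono:
  assumes \<mu>: "mass \<mu>" "full_support \<mu>" and \<psi>: "0 < \<psi>" "\<psi> < \<psi>'" "\<psi>' < pi"
  shows "measure \<mu> (halving_sector \<mu> \<phi> \<psi>) < measure \<mu> (halving_sector \<mu> \<phi> \<psi>')"
proof -
  let ?h = "halving_offset \<mu>"
  define n0 n1 n2 where "n0 = dir (\<phi> + pi/2)" "n1 = dir (\<phi> + \<psi> + pi/2)" "n2 = dir (\<phi> + \<psi>' + pi/2)"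
  define h0 h1 h2 where "h0 = ?h \<phi>" "h1 = ?h (\<phi> + \<psi>)" "h2 = ?h (\<phi> + \<psi>')"
  define s \<alpha> \<beta> where "s = sin \<psi>'" "\<alpha> = sin (\<psi>' - \<psi>)" "\<beta> = sin \<psi>"
  have pos: "0 < s" "0 < \<alpha>" "0 < \<beta>" using \<psi> by (auto simp: s_\<alpha>_\<beta>_def intro!: sin_gt_zero)
  define L Q0 where "L = left_half \<phi> h0" "Q0 = right_half \<phi> h0"
  define R1 Q1 where "R1 = right_half (\<phi> + \<psi>) h1" "Q1 = left_half (\<phi> + \<psi>) h1"
  define R2 Q2 where "R2 = right_half (\<phi> + \<psi>') h2" "Q2 = left_half (\<phi> + \<psi>') h2"
  note defs = L_Q0_def R1_Q1_def R2_Q2_def left_half_def right_half_def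
  note sets = half_sets[OF \<mu>(1)]
  have S: "L \<in> sets \<mu>" "Q0 \<in> sets \<mu>" "R1 \<in> sets \<mu>" "Q1 \<in> sets \<mu>" "R2 \<in> sets \<mu>" "Q2 \<in> sets \<mu>"
    by (simp_all add: L_Q0_def R1_Q1_def R2_Q2_def sets)
  have mem: "x \<in> L \<longleftrightarrow> h0 \<le> x \<bullet> n0" "x \<in> Q0 \<longleftrightarrow> x \<bullet> n0 \<le> h0" "x \<in> R1 \<longleftrightarrow> x \<bullet> n1 \<le> h1"
    "x \<in> Q1 \<longleftrightarrow> h1 \<le> x \<bullet> n1" "x \<in> R2 \<longleftrightarrow> x \<bullet> n2 \<le> h2" "x \<in> Q2 \<longleftrightarrow> h2 \<le> x \<bullet> n2" for x
    by (simp_all add: defs n0_n1_n2_def)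
  have rel: "s * (x \<bullet> n1) = \<alpha> * (x \<bullet> n0) + \<beta> * (x \<bullet> n2)" for x
  proof -
    have "s *\<^sub>R n1 = \<alpha> *\<^sub>R n0 + \<beta> *\<^sub>R n2"
      using dir_between[of \<psi>' "\<phi> + pi/2" \<psi>] by (simp add: n0_n1_n2_def s_\<alpha>_\<beta>_def ac_simps)
    then have "x \<bullet> (s *\<^sub>R n1) = x \<bullet> (\<alpha> *\<^sub>R n0 + \<beta> *\<^sub>R n2)" by simp
    then show ?thesis by (simp add: inner_add_right)
  qed
  have point: "\<exists>x. x \<bullet> n0 = A \<and> x \<bullet> n2 = B" for A B
    using point_with_coordinates[of \<psi>' \<phi> A B] pos by (auto simp: n0_n1_n2_def s_\<alpha>_\<beta>_def)
  have split1: "measure \<mu> X = measure \<mu> (X \<inter> R1) + measure \<mu> (X \<inter> Q1)"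
    and split2: "measure \<mu> X = measure \<mu> (X \<inter> R2) + measure \<mu> (X \<inter> Q2)"
    and split0: "measure \<mu> X = measure \<mu> (X \<inter> Q0) + measure \<mu> (X \<inter> L)" if "X \<in> sets \<mu>" for X
    unfolding L_Q0_def R1_Q1_def R2_Q2_def by (rule measure_split_line[OF \<mu>(1) that])+
  have halves: "measure \<mu> R1 = measure \<mu> R2"
    unfolding R1_Q1_def R2_Q2_def h0_h1_h2_def by (simp add: halving_offset[OF \<mu>])
  have opposite: "measure \<mu> (R1 \<inter> Q2) = measure \<mu> (R2 \<inter> Q1)"
    using split2[OF S(3)] split1[OF S(5)] halves by (simp add: Int_commute)
  have "measure \<mu> (L \<inter> R1 \<inter> Q2) < measure \<mu> (L \<inter> R2 \<inter> Q1)"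
  \<comment> \<open>By the relation between the normals, this says that the two lines cross at a point of L.\<close>
  proof (cases "\<alpha> * h0 \<le> s * h1 - \<beta> * h2")
    case True
    have "R2 \<inter> Q1 \<subseteq> L"
    proof
      fix x assume x: "x \<in> R2 \<inter> Q1"
      then have "s * h1 \<le> s * (x \<bullet> n1)" "\<beta> * (x \<bullet> n2) \<le> \<beta> * h2" using pos by (simp_all add: mem)
      then have "\<alpha> * h0 \<le> \<alpha> * (x \<bullet> n0)" using True rel[of x] by linarith
      then show "x \<in> L" using pos by (simp add: mem)
    qed
    then have "L \<inter> R2 \<inter> Q1 = R2 \<inter> Q1" by blast
    moreover have "0 < measure \<mu> (R1 \<inter> Q2 \<inter> Q0)"
    proof -
      let ?U = "{x. x \<bullet> n1 < h1 \<and> h2 < x \<bullet> n2 \<and> x \<bullet> n0 < h0}"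
      define A where "A = min (h0 - 1) ((s * h1 - \<beta> * (h2 + 1)) / \<alpha> - 1)"
      obtain x where x: "x \<bullet> n0 = A" "x \<bullet> n2 = h2 + 1" using point by blast
      have "\<alpha> * A < s * h1 - \<beta> * (h2 + 1)"
        using pos by (simp add: A_def mult.commute[of \<alpha>] flip: pos_less_divide_eq)
      then have "s * (x \<bullet> n1) < s * h1" unfolding rel x by linarith
      then have "x \<in> ?U" using x pos by (simp add: A_def)
      moreover have "open ?U" by (intro open_Collect_conj open_Collect_less continuous_intros)
      ultimately show ?thesis using S by (intro full_support_pos[OF \<mu>, of ?U x]) (auto simp: mem)
    qed
    moreover have "measure \<mu> (R1 \<inter> Q2) = measure \<mu> (R1 \<inter> Q2 \<inter> Q0) + measure \<mu> (L \<inter> R1 \<inter> Q2)"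
      using split0[of "R1 \<inter> Q2"] S by (simp add: Int_ac)
    ultimately show ?thesis using opposite by simp
  next
    case False
    have "x \<notin> L" if "x \<in> R1 \<inter> Q2" for x
    proof
      assume "x \<in> L"
      have "s * (x \<bullet> n1) \<le> s * h1" "\<beta> * h2 \<le> \<beta> * (x \<bullet> n2)" "\<alpha> * h0 \<le> \<alpha> * (x \<bullet> n0)"
        using pos that \<open>x \<in> L\<close> by (simp_all add: mem)
      then show False using False rel[of x] by linarith
    qed
    then have "L \<inter> R1 \<inter> Q2 = {}" by blast
    moreover have "0 < measure \<mu> (L \<inter> R2 \<inter> Q1)"
    proof -
      let ?U = "{x. h1 < x \<bullet> n1 \<and> x \<bullet> n2 < h2 \<and> h0 < x \<bullet> n0}"
      define A where "A = max (h0 + 1) ((s * h1 - \<beta> * (h2 - 1)) / \<alpha> + 1)"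
      obtain x where x: "x \<bullet> n0 = A" "x \<bullet> n2 = h2 - 1" using point by blast
      have "s * h1 - \<beta> * (h2 - 1) < \<alpha> * A"
        using pos by (simp add: A_def mult.commute[of \<alpha>] less_max_iff_disj flip: pos_divide_less_eq)
      then have "s * h1 < s * (x \<bullet> n1)" unfolding rel x by linarith
      then have "x \<in> ?U" using x pos by (simp add: A_def)
      moreover have "open ?U" by (intro open_Collect_conj open_Collect_less continuous_intros)
      ultimately show ?thesis using S by (intro full_support_pos[OF \<mu>, of ?U x]) (auto simp: mem)
    qed
    ultimately show ?thesis by simp
  qed
  then have "measure \<mu> (L \<inter> R1) < measure \<mu> (L \<inter> R2)"
    using split2[of "L \<inter> R1"] split1[of "L \<inter> R2"] S by (simp add: Int_ac)
  then show ?thesis by (simp add: halving_sector_def L_Q0_def R1_Q1_def R2_Q2_def h0_h1_h2_def)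
qed

lemma halving_sector_angle:
  assumes \<mu>: "mass \<mu>" "full_support \<mu>" and a: "0 < a" "a < 1/2"
  obtains \<tau> where "continuous_on UNIV \<tau>" "\<And>\<phi>. 0 < \<tau> \<phi> \<and> \<tau> \<phi> < pi"
    "\<And>\<phi>. measure \<mu> (halving_sector \<mu> \<phi> (\<tau> \<phi>)) = a" "\<And>\<phi>. \<tau> (\<phi> + pi) = \<tau> \<phi>"
proof -
  have ex: "\<exists>\<psi>. 0 < \<psi> \<and> \<psi> < pi \<and> measure \<mu> (halving_sector \<mu> \<phi> \<psi>) = a" for \<phi>
  proof -
    have "continuous_on {0..pi} (\<lambda>\<psi>. measure \<mu> (halving_sector \<mu> \<phi> \<psi>))"
      unfolding continuous_on_sequentially comp_def by (auto intro!: tendsto_halving_sector[OF \<mu>])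
    then have "\<exists>\<psi>\<ge>0. \<psi> \<le> pi \<and> measure \<mu> (halving_sector \<mu> \<phi> \<psi>) = a"
      using halving_sector_0_pi[OF \<mu>, of \<phi>] a by (intro IVT') auto
    then obtain \<psi> where \<psi>: "0 \<le> \<psi>" "\<psi> \<le> pi" "measure \<mu> (halving_sector \<mu> \<phi> \<psi>) = a" by blast
    then have "\<psi> \<noteq> 0" "\<psi> \<noteq> pi" using halving_sector_0_pi[OF \<mu>, of \<phi>] a by auto
    then show ?thesis using \<psi> by (intro exI[of _ \<psi>]) auto
  qed
  then obtain \<tau> where \<tau>: "\<And>\<phi>. 0 < \<tau> \<phi> \<and> \<tau> \<phi> < pi" "\<And>\<phi>. measure \<mu> (halving_sector \<mu> \<phi> (\<tau> \<phi>)) = a"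
    by metis
  have "continuous_on UNIV \<tau>"
  proof (rule continuous_on_root[where l = 0 and u = pi and s = a and g = "\<lambda>\<phi> \<psi>. measure \<mu> (halving_sector \<mu> \<phi> \<psi>)"])
    show "continuous_on UNIV (\<lambda>\<phi>. measure \<mu> (halving_sector \<mu> \<phi> \<psi>))" for \<psi>
      unfolding continuous_on_sequentially comp_def by (auto intro!: tendsto_halving_sector[OF \<mu>])
  qed (use \<tau> halving_sector_strict_mono[OF \<mu>] in auto)
  moreover have "\<tau> (\<phi> + pi) = \<tau> \<phi>" for \<phi>
  proof -
    have "measure \<mu> (halving_sector \<mu> \<phi> (\<tau> (\<phi> + pi))) = measure \<mu> (halving_sector \<mu> \<phi> (\<tau> \<phi>))"
      using halving_sector_plus_pi[OF \<mu>, of \<phi> "\<tau> (\<phi> + pi)"] \<tau>(2)[of \<phi>] \<tau>(2)[of "\<phi> + pi"] by simp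
    then show ?thesis
      using halving_sector_strict_mono[OF \<mu>, of "\<tau> \<phi>" "\<tau> (\<phi> + pi)" \<phi>]
        halving_sector_strict_mono[OF \<mu>, of "\<tau> (\<phi> + pi)" "\<tau> \<phi>" \<phi>] \<tau>(1)
      by (cases "\<tau> \<phi>" "\<tau> (\<phi> + pi)" rule: linorder_cases) auto
  qed
  ultimately show ?thesis using that \<tau> by blast
qed

text \<open>Turn a halving line of direction \<open>\<phi>\<close>, together with the two halving lines that cut off a sixth and a third
  with it. The function \<open>G\<close> is the signed distance, along the first line, between its intersections with the other
  two. After half a turn the lines are the same but the first one is reversed, so \<open>G\<close> changes its sign and
  has a zero. There the three lines are concurrent.\<close>

lemma six_partition:
  assumes \<mu>: "mass \<mu>" "full_support \<mu>"
  obtains c \<phi> \<psi>1 \<psi>2 where "0 < \<psi>1" "\<psi>1 < pi" "0 < \<psi>2" "\<psi>2 < pi"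
    "measure \<mu> (sweep c \<phi> (\<phi> + \<psi>1)) = 1/6" "measure \<mu> (sweep c \<phi> (\<phi> + \<psi>2)) = 1/3"
    "\<forall>t\<in>{\<phi>, \<phi> + \<psi>1, \<phi> + \<psi>2}. measure \<mu> (sweep c t (t + pi)) = 1/2"
proof -
  let ?h = "halving_offset \<mu>"
  obtain \<tau>1 where \<tau>1: "continuous_on UNIV \<tau>1" "\<And>\<phi>. 0 < \<tau>1 \<phi> \<and> \<tau>1 \<phi> < pi"
    "\<And>\<phi>. measure \<mu> (halving_sector \<mu> \<phi> (\<tau>1 \<phi>)) = 1/6" "\<And>\<phi>. \<tau>1 (\<phi> + pi) = \<tau>1 \<phi>"
    using halving_sector_angle[OF \<mu>, of "1/6"] by auto
  obtain \<tau>2 where \<tau>2: "continuous_on UNIV \<tau>2" "\<And>\<phi>. 0 < \<tau>2 \<phi> \<and> \<tau>2 \<phi> < pi"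
    "\<And>\<phi>. measure \<mu> (halving_sector \<mu> \<phi> (\<tau>2 \<phi>)) = 1/3" "\<And>\<phi>. \<tau>2 (\<phi> + pi) = \<tau>2 \<phi>"
    using halving_sector_angle[OF \<mu>, of "1/3"] by auto
  define s where "s \<psi> \<phi> = (?h \<phi> * cos \<psi> - ?h (\<phi> + \<psi>)) / sin \<psi>" for \<psi> \<phi>
  define G where "G \<phi> = s (\<tau>1 \<phi>) \<phi> - s (\<tau>2 \<phi>) \<phi>" for \<phi>
  have sin_pos: "0 < sin (\<tau>1 \<phi>)" "0 < sin (\<tau>2 \<phi>)" for \<phi>
    using \<tau>1(2)[of \<phi>] \<tau>2(2)[of \<phi>] by (auto intro: sin_gt_zero)
  have h_cont: "continuous_on UNIV (\<lambda>x. ?h (f x))" if "continuous_on UNIV f" for f :: "real \<Rightarrow> real"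
    by (rule continuous_on_compose2[OF continuous_halving_offset[OF \<mu>] that]) simp
  have "continuous_on UNIV G" unfolding G_def s_def
    by (intro continuous_intros h_cont \<tau>1(1) \<tau>2(1)) (use sin_pos in \<open>auto simp: less_le\<close>)
  have odd: "G (\<phi> + pi) = - G \<phi>" for \<phi>
  proof -
    have "s \<psi> (\<phi> + pi) = - s \<psi> \<phi>" for \<psi>
      using halving_offset_plus_pi[OF \<mu>, of \<phi>] halving_offset_plus_pi[OF \<mu>, of "\<phi> + \<psi>"]
      by (simp add: s_def ac_simps minus_divide_left)
    then show ?thesis by (simp add: G_def \<tau>1(4) \<tau>2(4))
  qed
  have "\<exists>\<phi>. G \<phi> = 0"
  proof (cases "G 0 \<le> 0")
    case True
    then have "\<exists>\<phi>\<ge>0. \<phi> \<le> pi \<and> G \<phi> = 0"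
      using odd[of 0] continuous_on_subset[OF \<open>continuous_on UNIV G\<close>] by (intro IVT') auto
    then show ?thesis by blast
  next
    case False
    then have "\<exists>\<phi>\<ge>0. \<phi> \<le> pi \<and> G \<phi> = 0"
      using odd[of 0] continuous_on_subset[OF \<open>continuous_on UNIV G\<close>] by (intro IVT2') auto
    then show ?thesis by blast
  qed
  then obtain \<phi> where \<phi>: "s (\<tau>1 \<phi>) \<phi> = s (\<tau>2 \<phi>) \<phi>" by (auto simp: G_def)
  define c where "c = s (\<tau>1 \<phi>) \<phi> *\<^sub>R dir \<phi> + ?h \<phi> *\<^sub>R dir (\<phi> + pi/2)"
  have c0: "c \<bullet> dir (\<phi> + pi/2) = ?h \<phi>" by (simp add: c_def inner_add_left inner_dir)
  have c1: "c \<bullet> dir (\<phi> + \<psi> + pi/2) = ?h (\<phi> + \<psi>)" if "\<psi> = \<tau>1 \<phi> \<or> \<psi> = \<tau>2 \<phi>" for \<psi>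
  proof -
    have "cos (\<phi> - (\<phi> + \<psi> + pi/2)) = - sin \<psi>" "cos (\<phi> + pi/2 - (\<phi> + \<psi> + pi/2)) = cos \<psi>"
      using cos_minus[of "\<psi> + pi/2"] cos_add[of \<psi> "pi/2"] by (simp_all add: algebra_simps)
    then have "c \<bullet> dir (\<phi> + \<psi> + pi/2) = - (s \<psi> \<phi> * sin \<psi>) + ?h \<phi> * cos \<psi>"
      using that \<phi> by (auto simp: c_def inner_add_left inner_dir)
    also have "s \<psi> \<phi> * sin \<psi> = ?h \<phi> * cos \<psi> - ?h (\<phi> + \<psi>)"
      using that sin_pos[of \<phi>] by (auto simp: s_def)
    finally show ?thesis by simp
  qed
  have half: "measure \<mu> (sweep c t (t + pi)) = 1/2" if "c \<bullet> dir (t + pi/2) = ?h t" for t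
  proof -
    have "sweep c t (t + pi) = left_half t (?h t)"
      unfolding sweep_halfplane left_half_def using that by (simp add: inner_diff_left)
    then show ?thesis by (simp add: halving_offset[OF \<mu>])
  qed
  have sector: "sweep c \<phi> (\<phi> + \<psi>) = halving_sector \<mu> \<phi> \<psi>" if "\<psi> = \<tau>1 \<phi> \<or> \<psi> = \<tau>2 \<phi>" for \<psi>
  proof -
    have "0 < \<psi>" "\<psi> \<le> pi" using that \<tau>1(2)[of \<phi>] \<tau>2(2)[of \<phi>] by auto
    then have "sweep c \<phi> (\<phi> + \<psi>) = {x. (x - c) \<bullet> dir (\<phi> + pi/2) \<ge> 0 \<and> (x - c) \<bullet> dir (\<phi> + \<psi> + pi/2) \<le> 0}"
      by (intro sweep_eq_halfplanes) auto
    then show ?thesis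
      using c0 c1[OF that] by (auto simp: halving_sector_def left_half_def right_half_def inner_diff_left)
  qed
  show ?thesis
  proof (rule that[of "\<tau>1 \<phi>" "\<tau>2 \<phi>" c \<phi>])
    show "\<forall>t\<in>{\<phi>, \<phi> + \<tau>1 \<phi>, \<phi> + \<tau>2 \<phi>}. measure \<mu> (sweep c t (t + pi)) = 1/2"
      using half[OF c0] half[OF c1[of "\<tau>1 \<phi>"]] half[OF c1[of "\<tau>2 \<phi>"]] by simp
  qed (use \<tau>1(2,3)[of \<phi>] \<tau>2(2,3)[of \<phi>] sector in auto)
qed

text \<open>By uniqueness of the fan starting at \<open>\<phi>\<close>, every \<open>m\<close>-th ray lies on one of the three lines, so that adding \<open>3m\<close> to an index
  that is divisible by \<open>m\<close> turns the ray by exactly \<open>\<pi>\<close>. A ray between two such rays is compared with the earlier of them.\<close>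

lemma equi_fan_narrow_six:
  assumes \<mu>: "mass \<mu>" "full_support \<mu>" and m: "0 < m"
  obtains c \<theta> where "equi_fan (6 * m) \<mu> c \<theta>" "narrow (2 * m + 1) \<theta>"
proof -
  obtain c \<phi> \<psi>1 \<psi>2 where \<psi>: "0 < \<psi>1" "\<psi>1 < pi" "0 < \<psi>2" "\<psi>2 < pi"
    and sixth: "measure \<mu> (sweep c \<phi> (\<phi> + \<psi>1)) = 1/6" and third: "measure \<mu> (sweep c \<phi> (\<phi> + \<psi>2)) = 1/3"
    and half: "\<forall>t\<in>{\<phi>, \<phi> + \<psi>1, \<phi> + \<psi>2}. measure \<mu> (sweep c t (t + pi)) = 1/2"
    by (rule six_partition[OF \<mu>]) (rule that; assumption)
  define \<theta> where "\<theta> = measure_fan \<mu> (6 * m) \<phi> c"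
  have fan: "equi_fan (6 * m) \<mu> c \<theta>" unfolding \<theta>_def using m by (intro equi_fan_measure_fan \<mu>) simp
  then have fan': "fan_angles (6 * m) \<theta>" by (simp add: equi_fan_def)
  have at: "\<theta> (k * m) = t"
    if "k < 6" "\<phi> \<le> t" "t \<le> \<phi> + 2 * pi" "measure \<mu> (sweep c \<phi> t) = real k / 6" for k t
  proof -
    have "k * m < 6 * m" using that m by simp
    then have "\<theta> (k * m) = split_angle \<mu> \<phi> (real k / 6) c"
      using m by (simp add: \<theta>_def measure_fan_def)
    also have "\<dots> = t" using split_angle_unique[OF \<mu> that(2,3), of c] that(4) by simp
    finally show ?thesis .
  qed
  have opp: "measure \<mu> (sweep c \<phi> (t + pi)) = measure \<mu> (sweep c \<phi> t) + 1/2"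
    if "t \<in> {\<phi>, \<phi> + \<psi>1, \<phi> + \<psi>2}" for t
    using measure_sweep_add[OF \<mu>(1), of \<phi> t "t + pi" c] half that \<psi> by auto
  have base: "\<theta> (0 * m) = \<phi>" "\<theta> (1 * m) = \<phi> + \<psi>1" "\<theta> (2 * m) = \<phi> + \<psi>2"
    "\<theta> (3 * m) = \<phi> + pi" "\<theta> (4 * m) = \<phi> + \<psi>1 + pi" "\<theta> (5 * m) = \<phi> + \<psi>2 + pi"
    by (rule at; use \<psi> sixth third opp[of \<phi>] opp[of "\<phi> + \<psi>1"] opp[of "\<phi> + \<psi>2"] \<mu>(1) in simp)+
  have base3: "\<theta> ((k + 3) * m) = \<theta> (k * m) + pi" if "k < 6" for k
  proof -
    have per: "\<theta> ((k + 6) * m) = \<theta> (k * m) + 2 * pi" for k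
      using fan_period[OF fan', of "k * m"] by (simp add: algebra_simps)
    consider "k = 0" | "k = 1" | "k = 2" | "k = 3" | "k = 4" | "k = 5" using \<open>k < 6\<close> by linarith
    then show ?thesis
      using base per[of 0] per[of 1] per[of 2] by cases simp_all
  qed
  have antipodal: "\<theta> ((k + 3) * m) = \<theta> (k * m) + pi" for k
  proof -
    have "\<theta> (j * m) = \<theta> (j mod 6 * m) + 2 * pi * real (j div 6)" for j
      using fan_shift[OF fan', of "j mod 6 * m" "j div 6"] mod_mult_div_eq[of j 6]
      by (metis (no_types) add_mult_distrib mult.assoc mult.commute)
    note red = this
    have "\<theta> ((k + 3) * m) = \<theta> ((k mod 6 + 3) * m) + 2 * pi * real (k div 6)"
      using fan_shift[OF fan', of "(k mod 6 + 3) * m" "k div 6"] mod_mult_div_eq[of k 6]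
      by (metis (no_types, opaque_lifting) add.assoc add.commute add_mult_distrib mult.assoc mult.commute)
    then show ?thesis using base3[of "k mod 6"] red[of k] by simp
  qed
  have "narrow (2 * m + 1) \<theta>"
    unfolding narrow_def
  proof
    fix i
    define k where "k = i div m"
    have i: "k * m \<le> i" "i < (k + 1) * m"
      using m dividend_less_div_times[of m i] by (simp_all add: k_def)
    have "\<theta> (i + (2 * m + 1)) \<le> \<theta> ((k + 3) * m)"
      unfolding fan_le_iff[OF fan'] using i by (simp add: algebra_simps)
    also have "\<dots> = \<theta> (k * m) + pi" by (rule antipodal)
    also have "\<dots> \<le> \<theta> i + pi" using i by (simp add: fan_le_iff[OF fan'])
    finally show "\<theta> (i + (2 * m + 1)) \<le> \<theta> i + pi" .
  qed
  then show ?thesis using fan that by blast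
qed

section \<open>From masses of full support to arbitrary masses\<close>

text \<open>Lebesgue measure is sigma-finite and thus has a strictly positive integrable density; the mass is the normalized
  measure with such a density.\<close>

lemma ex_full_support_mass:
  obtains \<nu> where "mass \<nu>" "full_support \<nu>"
proof -
  obtain f :: "real^2 \<Rightarrow> ennreal" where f: "f \<in> borel_measurable lborel" "integral\<^sup>N lborel f \<noteq> \<infinity>"
    "\<And>x. 0 < f x" "\<And>x. f x < \<infinity>"
    using sigma_finite_measure.Ex_finite_integrable_function[OF sigma_finite_lborel] by auto
  define D where "D = density lborel f"
  define K where "K = emeasure D UNIV"
  have K: "K = integral\<^sup>N lborel f" unfolding K_def D_def using f(1) by (simp add: emeasure_density)
  have pos: "0 < emeasure D U" if "open U" "U \<noteq> {}" for U
  proof (rule ccontr)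
    assume "\<not> 0 < emeasure D U"
    then have "U \<in> null_sets D" using that by (intro null_setsI) (auto simp: D_def zero_less_iff_neq_zero)
    then have "AE x in lborel. x \<in> U \<longrightarrow> f x = 0"
      unfolding D_def by (subst (asm) null_sets_density_iff[OF f(1)]) simp
    then have "AE x in lborel. x \<notin> U" using f(3) by (auto elim!: eventually_mono simp: less_le)
    then have "U \<in> null_sets lborel" using that by (subst AE_iff_null_sets) auto
    then have "negligible U" by (simp add: negligible_iff_null_sets null_sets_completionI)
    then show False using open_not_negligible[OF that] by blast
  qed
  have K0: "K \<noteq> 0" "K \<noteq> \<infinity>" using pos[of UNIV] f(2) by (auto simp: K_def [symmetric] K)
  define \<nu> where "\<nu> = uniform_measure D UNIV"
  have D_sets: "sets D = sets borel" by (simp add: D_def)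
  have \<nu>: "emeasure \<nu> A = emeasure D A / K" if "A \<in> sets borel" for A
    unfolding \<nu>_def K_def using that D_sets by (subst emeasure_uniform_measure) auto
  have prob: "prob_space \<nu>" unfolding \<nu>_def
    by (rule prob_space_uniform_measure) (use K0 in \<open>auto simp: K_def\<close>)
  interpret prob_space \<nu> by (rule prob)
  have "measure \<nu> L = 0" if L: "affine L" "aff_dim L = 1" for L
  proof -
    have null: "L \<in> null_sets lborel" by (rule affine_line_null_lborel[OF L])
    then have "L \<in> null_sets D"
      unfolding D_def using AE_not_in[OF null] by (subst null_sets_density_iff[OF f(1)]) auto
    moreover have "L \<in> sets borel" using null by (auto dest: null_setsD2)
    ultimately show ?thesis using \<nu>[of L] by (simp add: measure_def null_setsD1)
  qed
  then have "mass \<nu>" using prob D_sets by (simp add: mass_def \<nu>_def)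
  moreover have "full_support \<nu>"
    unfolding full_support_def
  proof (intro allI impI)
    fix U :: "(real^2) set" assume U: "open U \<and> U \<noteq> {}"
    then have "0 < emeasure \<nu> U"
      using pos[of U] \<nu>[of U] K0 by (simp add: ennreal_zero_less_divide less_top)
    then show "0 < measure \<nu> U" by (simp add: emeasure_eq_measure)
  qed
  ultimately show ?thesis by (rule that)
qed

text \<open>The mixture is realized by a coin toss that selects one of the two masses.\<close>

lemma mass_mixture:
  assumes \<mu>: "mass \<mu>" and \<nu>: "mass \<nu>" and t: "0 \<le> t" "t \<le> 1"
  obtains M where "mass M" "\<And>A. A \<in> sets borel \<Longrightarrow> measure M A = (1 - t) * measure \<mu> A + t * measure \<nu> A"
proof -
  interpret \<mu>: prob_space \<mu> using mass_facts \<mu> by blast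
  interpret \<nu>: prob_space \<nu> using mass_facts \<nu> by blast
  define N where "N b = (if b then \<nu> else \<mu>)" for b
  define M where "M = measure_pmf (bernoulli_pmf t) \<bind> N"
  have N: "N \<in> measurable (measure_pmf (bernoulli_pmf t)) (subprob_algebra borel)"
    using mass_facts(3)[OF \<mu>] mass_facts(3)[OF \<nu>]
    by (auto simp: N_def space_subprob_algebra \<mu>.subprob_space_axioms \<nu>.subprob_space_axioms
        prob_space_imp_subprob_space \<mu>.prob_space_axioms \<nu>.prob_space_axioms)
  have em: "emeasure M A = ennreal ((1 - t) * measure \<mu> A + t * measure \<nu> A)" if "A \<in> sets borel" for A
  proof -
    have "emeasure M A = (\<integral>\<^sup>+ b. emeasure (N b) A \<partial>measure_pmf (bernoulli_pmf t))"
      unfolding M_def by (rule emeasure_bind[OF _ N that]) simp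
    also have "\<dots> = ennreal t * emeasure \<nu> A + ennreal (1 - t) * emeasure \<mu> A"
      using t by (simp add: nn_integral_bernoulli_pmf N_def mult.commute)
    also have "\<dots> = ennreal ((1 - t) * measure \<mu> A + t * measure \<nu> A)"
      using t by (simp add: \<mu>.emeasure_eq_measure \<nu>.emeasure_eq_measure ennreal_mult'[symmetric] ennreal_plus[symmetric] add.commute del: ennreal_plus)
    finally show ?thesis .
  qed
  have sets: "sets M = sets borel" unfolding M_def by (rule sets_bind) (use mass_facts(3)[OF \<mu>] mass_facts(3)[OF \<nu>] in \<open>auto simp: N_def\<close>)
  have meas: "measure M A = (1 - t) * measure \<mu> A + t * measure \<nu> A" if "A \<in> sets borel" for A
    by (rule measure_eq_emeasure_eq_ennreal[OF _ em[OF that]]) (use t in simp)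
  have "mass M"
    unfolding mass_def
  proof (intro conjI allI impI)
    show "prob_space M"
    proof
      have "space M = UNIV" using sets_eq_imp_space_eq[OF sets] by simp
      then show "emeasure M (space M) = 1"
        using em[of UNIV] \<mu>.prob_space \<nu>.prob_space by (simp add: mass_facts(4) \<mu> \<nu>)
    qed
    show "sets M = sets borel" by (rule sets)
    fix L :: "(real^2) set" assume L: "affine L \<and> aff_dim L = 1"
    then have "L \<in> sets borel" by (simp add: borel_closed affine_closed)
    then show "measure M L = 0" using L meas \<mu> \<nu> by (simp add: mass_def)
  qed
  then show ?thesis using meas that by blast
qed

lemma simultaneous_convergent_subsequence:
  fixes f :: "nat \<Rightarrow> nat \<Rightarrow> real"
  assumes "\<And>j. j < N \<Longrightarrow> bounded (range (f j))"
  obtains r where "strict_mono r" "\<And>j. j < N \<Longrightarrow> convergent (f j \<circ> r)"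
  using assms
proof (induction N arbitrary: thesis)
  case 0
  show ?case by (rule 0(1)[of id]) (simp_all add: strict_mono_id)
next
  case (Suc N)
  obtain r where r: "strict_mono r" "\<And>j. j < N \<Longrightarrow> convergent (f j \<circ> r)"
    using Suc.IH Suc.prems(2) by (metis less_Suc_eq)
  have "bounded (range (f N \<circ> r))"
    by (rule bounded_subset[OF Suc.prems(2)[of N]]) auto
  then obtain l r' where r': "strict_mono r'" "((f N \<circ> r) \<circ> r') \<longlonglongrightarrow> l"
    using bounded_imp_convergent_subsequence by blast
  show ?case
  proof (rule Suc.prems(1)[of "r \<circ> r'"])
    show "strict_mono (r \<circ> r')" by (rule strict_mono_o[OF r(1) r'(1)])
    fix j assume "j < Suc N"
    then consider "j = N" | "j < N" by linarith
    then show "convergent (f j \<circ> (r \<circ> r'))"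
    proof cases
      case 1 then show ?thesis using r'(2) by (auto simp: convergent_def comp_assoc)
    next
      case 2 then show ?thesis
        using convergent_subseq_convergent[OF r(2) r'(1)] by (simp add: comp_assoc)
    qed
  qed
qed

lemma equi_fan_rotate:
  assumes "equi_fan q \<mu> c \<theta>" "narrow p \<theta>"
  obtains \<theta>' where "equi_fan q \<mu> c \<theta>'" "narrow p \<theta>'" "0 \<le> \<theta>' 0" "\<theta>' 0 < 2 * pi"
proof -
  define k where "k = - \<lfloor>\<theta> 0 / (2 * pi)\<rfloor>"
  define \<theta>' where "\<theta>' i = \<theta> i + 2 * pi * of_int k" for i
  have "equi_fan q \<mu> c \<theta>'" using assms(1)
    unfolding equi_fan_def fan_angles_def \<theta>'_def by (simp only: sweep_shift) simp
  moreover have "narrow p \<theta>'" using assms(2) by (simp add: narrow_def \<theta>'_def)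
  moreover have "\<theta>' 0 = 2 * pi * frac (\<theta> 0 / (2 * pi))"
    by (simp add: \<theta>'_def k_def frac_def algebra_simps)
  then have "0 \<le> \<theta>' 0" "\<theta>' 0 < 2 * pi" using frac_lt_1[of "\<theta> 0 / (2 * pi)"] by simp_all
  ultimately show ?thesis using that by blast
qed

text \<open>From a remote apex the half plane facing away from the origin is too light for \<open>equi_fan_depth\<close>.\<close>

lemma narrow_equi_fan_apex_bounded:
  assumes \<mu>: "mass \<mu>" and pq: "2 \<le> p" "p < q" and fan: "equi_fan q \<mu> c \<theta>" "narrow p \<theta>"
    and R: "measure \<mu> {x. R \<le> norm x} < 1 / real q"
  shows "norm c < R"
proof (rule ccontr)
  assume "\<not> norm c < R"
  interpret finite_measure \<mu> using mass_facts \<mu> by blast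
  obtain \<psi> where \<psi>: "sweep c (\<psi> - pi/2) (\<psi> + pi/2) \<subseteq> {x. norm c \<le> norm x}"
    using halfplane_avoids_ball[OF refl] by blast
  have "closed {x :: real^2. R \<le> norm x}" by (intro closed_Collect_le continuous_intros)
  then have tail: "{x. R \<le> norm x} \<in> sets \<mu>" by (simp add: mass_facts(3)[OF \<mu>] borel_closed)
  have "1 / real q \<le> (real p - 1) / real q" using pq by (intro divide_right_mono) auto
  also have "\<dots> \<le> measure \<mu> (sweep c (\<psi> - pi/2) (\<psi> - pi/2 + pi))"
    by (rule equi_fan_depth[OF \<mu> _ _ fan]) (use pq in auto)
  also have "\<dots> \<le> measure \<mu> {x. R \<le> norm x}"
    using \<psi> \<open>\<not> norm c < R\<close> tail by (intro finite_measure_mono) (auto simp: add.commute)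
  finally show False using R by simp
qed

text \<open>The mixtures with weight \<open>1 / (n + 1)\<close> on a mass of full support converge to \<open>\<mu>\<close> uniformly on Borel sets.
  Limits of consecutive rays are still distinct, because the wedge between them keeps measure \<open>1 / q\<close> while a ray is null.\<close>

lemma equi_fan_narrow_limit:
  assumes full: "\<And>\<mu>. mass \<mu> \<Longrightarrow> full_support \<mu> \<Longrightarrow> \<exists>c \<theta>. equi_fan q \<mu> c \<theta> \<and> narrow p \<theta>"
    and pq: "2 \<le> p" "p < q" and \<mu>: "mass \<mu>"
  obtains c \<theta> where "equi_fan q \<mu> c \<theta>" "narrow p \<theta>"
proof -
  have q: "0 < q" using pq by simp
  interpret finite_measure \<mu> using mass_facts \<mu> by blast
  obtain \<nu> where \<nu>: "mass \<nu>" "full_support \<nu>" using ex_full_support_mass .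
  interpret \<nu>: prob_space \<nu> using mass_facts \<nu> by blast
  interpret \<mu>: prob_space \<mu> using mass_facts \<mu> by blast
  define \<epsilon> where "\<epsilon> n = inverse (real (Suc n))" for n
  have \<epsilon>: "0 < \<epsilon> n" "\<epsilon> n \<le> 1" for n by (auto simp: \<epsilon>_def inverse_le_1_iff)
  have \<epsilon>_lim: "\<epsilon> \<longlonglongrightarrow> 0" unfolding \<epsilon>_def [abs_def] by (rule LIMSEQ_inverse_real_of_nat)
  have "\<exists>M. mass M \<and> (\<forall>A\<in>sets borel. measure M A = (1 - \<epsilon> n) * measure \<mu> A + \<epsilon> n * measure \<nu> A)" for n
    using mass_mixture[OF \<mu> \<nu>(1), of "\<epsilon> n"] \<epsilon>[of n] by (metis less_imp_le)
  then obtain M where M: "\<And>n. mass (M n)"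
    "\<And>n A. A \<in> sets borel \<Longrightarrow> measure (M n) A = (1 - \<epsilon> n) * measure \<mu> A + \<epsilon> n * measure \<nu> A"
    by metis
  have M_full: "full_support (M n)" for n
    unfolding full_support_def
  proof (intro allI impI)
    fix U :: "(real^2) set" assume U: "open U \<and> U \<noteq> {}"
    then have "0 < \<epsilon> n * measure \<nu> U" using \<nu>(2) \<epsilon>(1)[of n] by (simp add: full_support_def)
    moreover have "0 \<le> (1 - \<epsilon> n) * measure \<mu> U" using \<epsilon>(2)[of n] by simp
    ultimately show "0 < measure (M n) U" using U by (simp add: M(2))
  qed
  have "\<exists>c \<theta>. equi_fan q (M n) c \<theta> \<and> narrow p \<theta> \<and> 0 \<le> \<theta> 0 \<and> \<theta> 0 < 2 * pi" for n
    using full[OF M(1) M_full, of n] equi_fan_rotate by metis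
  then obtain c \<theta> where fan: "\<And>n. equi_fan q (M n) (c n) (\<theta> n)" "\<And>n. narrow p (\<theta> n)"
    "\<And>n. 0 \<le> \<theta> n 0 \<and> \<theta> n 0 < 2 * pi"
    by metis
  have fan': "fan_angles q (\<theta> n)" for n using fan(1)[of n] by (simp add: equi_fan_def)
  obtain R1 where R1: "0 < R1" "measure \<mu> {x. R1 \<le> norm x} < 1 / real q"
    using mass_tail[OF \<mu>, of "1 / real q"] q by auto
  obtain R2 where R2: "0 < R2" "measure \<nu> {x. R2 \<le> norm x} < 1 / real q"
    using mass_tail[OF \<nu>(1), of "1 / real q"] q by auto
  define R where "R = max R1 R2"
  have closed: "closed {x :: real^2. r \<le> norm x}" for r by (intro closed_Collect_le continuous_intros)
  have "norm (c n) < R" for n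
  proof (rule narrow_equi_fan_apex_bounded[OF M(1) pq fan(1,2)])
    have a: "measure \<mu> {x. R \<le> norm x} < 1 / real q"
      using finite_measure_mono[of "{x. R \<le> norm x}" "{x. R1 \<le> norm x}"] R1 closed
      by (force simp: R_def mass_facts(3)[OF \<mu>] borel_closed)
    have b: "measure \<nu> {x. R \<le> norm x} < 1 / real q"
      using \<nu>.finite_measure_mono[of "{x. R \<le> norm x}" "{x. R2 \<le> norm x}"] R2 closed
      by (force simp: R_def mass_facts(3)[OF \<nu>(1)] borel_closed)
    have "(1 - \<epsilon> n) * measure \<mu> {x. R \<le> norm x} \<le> (1 - \<epsilon> n) * (1 / real q)"
      using a \<epsilon>[of n] by (intro mult_left_mono) auto
    moreover have "\<epsilon> n * measure \<nu> {x. R \<le> norm x} < \<epsilon> n * (1 / real q)"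
      using b \<epsilon>[of n] by (intro mult_strict_left_mono) auto
    ultimately have "(1 - \<epsilon> n) * measure \<mu> {x. R \<le> norm x} + \<epsilon> n * measure \<nu> {x. R \<le> norm x} < 1 / real q"
      using distrib_right[of "1 - \<epsilon> n" "\<epsilon> n" "1 / real q"] by simp
    then show "measure (M n) {x. R \<le> norm x} < 1 / real q"
      by (subst M(2)) (use closed in \<open>auto simp: borel_closed\<close>)
  qed
  then have "bounded (range c)" by (auto simp: bounded_iff intro: less_imp_le)
  then obtain c0 r1 where r1: "strict_mono r1" "(c \<circ> r1) \<longlonglongrightarrow> c0"
    using bounded_imp_convergent_subsequence by blast
  have \<theta>_bound: "0 \<le> \<theta> n j" "\<theta> n j \<le> 2 * pi * real (j + 1)" for n j
  proof -
    show "0 \<le> \<theta> n j" using fan(3)[of n] fan_le_iff[OF fan'[of n], of 0 j] by simp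
    have "\<theta> n j \<le> \<theta> n (0 + j * q)" unfolding fan_le_iff[OF fan'] using q by simp
    also have "\<dots> = \<theta> n 0 + 2 * pi * real j" by (rule fan_shift[OF fan'])
    also have "\<dots> \<le> 2 * pi * real (j + 1)" using fan(3)[of n] by (simp add: algebra_simps)
    finally show "\<theta> n j \<le> 2 * pi * real (j + 1)" .
  qed
  have "bounded (range (\<lambda>n. \<theta> (r1 n) j))" for j
    unfolding bounded_iff using \<theta>_bound[of _ j] by (auto intro!: exI[of _ "2 * pi * real (j + 1)"])
  then obtain r2 where r2: "strict_mono r2" "\<And>j. j < q \<Longrightarrow> convergent ((\<lambda>n. \<theta> (r1 n) j) \<circ> r2)"
    using simultaneous_convergent_subsequence[of q "\<lambda>j n. \<theta> (r1 n) j"] by blast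
  define r where "r = r1 \<circ> r2"
  have r: "strict_mono r" unfolding r_def by (rule strict_mono_o[OF r1(1) r2(1)])
  have c_lim: "(\<lambda>n. c (r n)) \<longlonglongrightarrow> c0"
    using LIMSEQ_subseq_LIMSEQ[OF r1(2) r2(1)] by (simp add: r_def comp_def)
  define \<theta>0 where "\<theta>0 j = lim (\<lambda>n. \<theta> (r n) j)" for j
  have \<theta>_lim: "(\<lambda>n. \<theta> (r n) j) \<longlonglongrightarrow> \<theta>0 j" for j
  proof -
    have "(\<lambda>n. \<theta> (r n) j) = (\<lambda>n. \<theta> (r n) (j mod q) + 2 * pi * real (j div q))"
    proof
      show "\<theta> (r n) j = \<theta> (r n) (j mod q) + 2 * pi * real (j div q)" for n
        using fan_shift[OF fan'[of "r n"], of "j mod q" "j div q"] by simp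
    qed
    moreover have "convergent (\<lambda>n. \<theta> (r n) (j mod q))"
      using r2(2)[of "j mod q"] q by (simp add: r_def comp_def)
    ultimately have "convergent (\<lambda>n. \<theta> (r n) j)"
      by (simp only: convergent_add convergent_const)
    then show ?thesis unfolding \<theta>0_def by (simp add: convergent_LIMSEQ_iff)
  qed
  have step: "\<theta> n i \<le> \<theta> n (Suc i)" "\<theta> n (Suc i) \<le> \<theta> n i + 2 * pi" for n i
    using fan_le_iff[OF fan'[of n], of i "Suc i"] fan_width[OF fan'[of n], of 1 i] q by simp_all
  have mes: "measure \<mu> (sweep c0 (\<theta>0 i) (\<theta>0 (Suc i))) = 1 / real q" for i
  proof -
    let ?S = "\<lambda>n. sweep (c (r n)) (\<theta> (r n) i) (\<theta> (r n) (Suc i))"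
    have "(\<lambda>n. measure \<mu> (?S n)) \<longlonglongrightarrow> measure \<mu> (sweep c0 (\<theta>0 i) (\<theta>0 (Suc i)))"
      by (rule tendsto_measure_sweep[OF \<mu> c_lim \<theta>_lim \<theta>_lim]) (use step in auto)
    moreover have "(\<lambda>n. measure \<mu> (?S n)) \<longlonglongrightarrow> 1 / real q"
    proof -
      have S: "?S n \<in> sets borel" for n using sweep_sets[OF \<mu>, of "\<theta> (r n) i"] step by (simp add: mass_facts(3)[OF \<mu>])
      have eq: "measure \<mu> (?S n) = 1 / real q - \<epsilon> (r n) * (measure \<nu> (?S n) - measure \<mu> (?S n))" for n
      proof -
        have "measure (M (r n)) (?S n) = 1 / real q" using fan(1)[of "r n"] by (simp add: equi_fan_def)
        then show ?thesis using M(2)[OF S[of n], of "r n"] by (simp add: algebra_simps)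
      qed
      have small: "(\<lambda>n. \<epsilon> (r n)) \<longlonglongrightarrow> 0" using LIMSEQ_subseq_LIMSEQ[OF \<epsilon>_lim r] by (simp add: comp_def)
      have "(\<lambda>n. \<epsilon> (r n) * (measure \<nu> (?S n) - measure \<mu> (?S n))) \<longlonglongrightarrow> 0"
      proof (rule Lim_null_comparison[OF _ small])
        show "\<forall>\<^sub>F n in sequentially. norm (\<epsilon> (r n) * (measure \<nu> (?S n) - measure \<mu> (?S n))) \<le> \<epsilon> (r n)"
        proof (rule always_eventually, rule allI)
          fix n
          have "\<bar>measure \<nu> (?S n) - measure \<mu> (?S n)\<bar> \<le> 1"
            using \<nu>.prob_le_1[of "?S n"] \<mu>.prob_le_1[of "?S n"] measure_nonneg[of \<nu> "?S n"] measure_nonneg[of \<mu> "?S n"] by linarith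
          then show "norm (\<epsilon> (r n) * (measure \<nu> (?S n) - measure \<mu> (?S n))) \<le> \<epsilon> (r n)"
            using \<epsilon>(1)[of "r n"] by (simp add: abs_mult mult_left_le)
        qed
      qed
      from tendsto_diff[OF tendsto_const[of "1 / real q"] this] show ?thesis
        unfolding eq[symmetric] by (simp only: diff_zero)
    qed
    ultimately show ?thesis by (rule LIMSEQ_unique)
  qed
  have "\<theta>0 i < \<theta>0 (Suc i)" for i
  proof -
    have "\<theta>0 i \<le> \<theta>0 (Suc i)" by (rule LIMSEQ_le[OF \<theta>_lim \<theta>_lim]) (use step in auto)
    moreover have "\<theta>0 i \<noteq> \<theta>0 (Suc i)"
    proof
      assume "\<theta>0 i = \<theta>0 (Suc i)"
      then show False using mes[of i] measure_ray[OF \<mu>, of c0 "\<theta>0 (Suc i)"] q by simp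
    qed
    ultimately show ?thesis by simp
  qed
  moreover have "\<theta>0 (i + q) = \<theta>0 i + 2 * pi" for i
  proof (rule LIMSEQ_unique[OF \<theta>_lim])
    show "(\<lambda>n. \<theta> (r n) (i + q)) \<longlonglongrightarrow> \<theta>0 i + 2 * pi"
      unfolding fan_period[OF fan'] by (intro tendsto_intros \<theta>_lim)
  qed
  ultimately have "equi_fan q \<mu> c0 \<theta>0" using mes by (simp add: equi_fan_def fan_angles_def)
  moreover have "narrow p \<theta>0"
    unfolding narrow_def
  proof
    fix i
    show "\<theta>0 (i + p) \<le> \<theta>0 i + pi"
      by (rule LIMSEQ_le[OF \<theta>_lim tendsto_add[OF \<theta>_lim tendsto_const]])
         (use fan(2) in \<open>auto simp: narrow_def\<close>)
  qed
  ultimately show ?thesis by (rule that)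
qed

lemma equi_fan_narrow_above_threshold:
  assumes "mass \<mu>" "2 \<le> p" "p < q" "3 * p < q + 3"
  obtains c \<theta> where "equi_fan q \<mu> c \<theta>" "narrow p \<theta>"
proof -
  have "\<exists>c \<theta>. equi_fan q \<mu> c \<theta> \<and> narrow p \<theta>" if "mass \<mu>" "full_support \<mu>" for \<mu>
    using equi_fan_narrow_full_support[OF that assms(2-4)] by blast
  then show ?thesis using equi_fan_narrow_limit[OF _ assms(2,3,1)] that by blast
qed

text \<open>The argument with bad wedges needs \<open>p \<ge> 2\<close>. A fan of \<open>2q\<close> rays that is narrow for \<open>2\<close> steps becomes, after
  dropping every second ray, a fan of \<open>q\<close> rays that is narrow for one step.\<close>

theorem equicovering_if_q_ge:
  assumes "mass \<mu>" "0 < p" "p < q" "3 * p < q + 3" "2 \<le> p \<or> 3 \<le> q"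
  shows "admits_convex_spiral_equicovering q p \<mu>"
proof (cases "p = 1")
  case False
  then show ?thesis using assms equi_fan_narrow_above_threshold[of \<mu> p q] equi_fan_admits[of \<mu> p q] by (metis One_nat_def Suc_leI le_neq_implies_less Suc_1)
next
  case True
  then have "3 \<le> q" using assms by simp
  then obtain c \<theta> where fan: "equi_fan (2 * q) \<mu> c \<theta>" "narrow 2 \<theta>"
    using equi_fan_narrow_above_threshold[OF assms(1), of 2 "2 * q"] by auto
  define \<theta>' where "\<theta>' i = \<theta> (2 * i)" for i
  have fan': "fan_angles (2 * q) \<theta>" using fan by (simp add: equi_fan_def)
  have "measure \<mu> (sweep c (\<theta>' i) (\<theta>' (Suc i))) = 1 / real q" for i
    using equi_fan_measure[OF assms(1) fan(1), of 2 "2 * i"] \<open>3 \<le> q\<close> by (simp add: \<theta>'_def)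
  moreover have "fan_angles q \<theta>'"
    using fan' fan_period[OF fan'] unfolding fan_angles_def \<theta>'_def
    by (simp add: fan_less_iff[OF fan'] distrib_left)
  ultimately have "equi_fan q \<mu> c \<theta>'" by (simp add: equi_fan_def)
  moreover have "narrow 1 \<theta>'" using fan(2) by (simp add: narrow_def \<theta>'_def)
  ultimately show ?thesis using assms True by (intro equi_fan_admits) auto
qed

theorem equicovering_if_q_eq:
  assumes "mass \<mu>" "p < q" "q = 3 * p - 3" "odd p"
  shows "admits_convex_spiral_equicovering q p \<mu>"
proof -
  obtain m where p: "p = 2 * m + 1" using assms(4) oddE by blast
  then have q: "q = 6 * m" "0 < m" using assms by auto
  have "\<exists>c \<theta>. equi_fan q \<mu> c \<theta> \<and> narrow p \<theta>" if "mass \<mu>" "full_support \<mu>" for \<mu>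
    using equi_fan_narrow_six[OF that q(2)] unfolding p q(1) by blast
  then obtain c \<theta> where "equi_fan q \<mu> c \<theta>" "narrow p \<theta>"
    using equi_fan_narrow_limit[of q p \<mu>] assms p q by auto
  then show ?thesis using assms p by (intro equi_fan_admits) auto
qed

theorem theorem1p1:
  fixes p q :: nat
  assumes "0 < p" and "p < q" and "coprime p q"
  shows "(q < 2 * p \<longrightarrow> (\<exists>\<mu>. mass \<mu> \<and> \<not> admits_convex_spiral_equicovering q p \<mu>))
    \<and> (q < 3 * p - 3 \<longrightarrow> (\<exists>\<mu>. mass \<mu> \<and> \<not> admits_convex_spiral_equicovering q p \<mu>))
    \<and> (q = 3 * p - 3 \<and> odd p \<longrightarrow> (\<forall>\<mu>. mass \<mu> \<longrightarrow> admits_convex_spiral_equicovering q p \<mu>))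
    \<and> (3 * p - 3 < q \<and> q < 3 * p \<and> 2 \<le> p \<longrightarrow>
        (\<forall>\<mu>. mass \<mu> \<longrightarrow> admits_convex_spiral_equicovering q p \<mu>))
    \<and> (3 * p \<le> q \<longrightarrow> (\<forall>\<mu>. mass \<mu> \<longrightarrow> admits_convex_spiral_equicovering q p \<mu>))"
proof (intro conjI impI allI)
  assume "q < 2 * p"
  then show "\<exists>\<mu>. mass \<mu> \<and> \<not> admits_convex_spiral_equicovering q p \<mu>" using no_equicovering assms by blast
next
  assume "q < 3 * p - 3"
  then show "\<exists>\<mu>. mass \<mu> \<and> \<not> admits_convex_spiral_equicovering q p \<mu>" using no_equicovering assms by blast
next
  fix \<mu> :: "(real^2) measure" assume "mass \<mu>" "q = 3 * p - 3 \<and> odd p"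
  then show "admits_convex_spiral_equicovering q p \<mu>" using equicovering_if_q_eq assms by blast
next
  fix \<mu> :: "(real^2) measure" assume "mass \<mu>" "3 * p - 3 < q \<and> q < 3 * p \<and> 2 \<le> p"
  then show "admits_convex_spiral_equicovering q p \<mu>" using assms by (intro equicovering_if_q_ge) auto
next
  fix \<mu> :: "(real^2) measure" assume "mass \<mu>" "3 * p \<le> q"
  then show "admits_convex_spiral_equicovering q p \<mu>" using assms by (intro equicovering_if_q_ge) auto
qed

end
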